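(* Let $\mathbf{C}_2$ be a cycle poset with underlying crown $\mathscr{C}_2$, let $\mathcal{T}=\{(\mathbf{T}_v,r_v)\mid v\in\mathbf{C}_2\}$ be a family of rooted tree posets indexed by $\mathbf{C}_2$, and let $P$ be the unicycle poset obtained as the grafting of $\mathcal{T}$ on $\mathbf{C}_2$. Then the following three linear orders form a realizer of $P$: $$A_1(X_1^-)\, X_2^-\, B_{2}(Z_1^\bullet)\, B_4^3(Z_2^\bullet)\, I_{x_1}^+\, I_{x_2}^+,$$ $$I_{z_2}^-\, I_{z_1}^-\, A_3^2(X_2^\bullet)\, A_4(X_1^\bullet)\, Z_2^+\, B_1(Z_1^+),$$ $$I_{x_1}^-\, X_1^+\, C_4\, I_{x_2}^-\, X_2^+\, C_1\, C_3\, Z_2^-\, I_{z_2}^+\, C_2\, Z_1^-\, I_{z_1}^+.$$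
   Context: All posets are finite. Linear orders on a finite set are written as words, listing elements from smallest to largest; juxtaposition is concatenation. $\prod^{\nearrow}_{a\le i\le b}w_i=w_aw_{a+1}\cdots w_b$ and $\prod^{\searrow}_{a\le i\le b}w_i=w_bw_{b-1}\cdots w_a$, both being the empty word if $b<a$. A realizer of a poset $P$ is a list of linear extensions of $P$ (repetitions allowed) such that $u\le v$ in $P$ if and only if $u\le v$ in each of them. The cover graph of a poset is its undirected Hasse diagram; a tree poset is a poset whose cover graph is a tree; a rooted tree poset is a pair $(\mathbf{T},r)$ with $\mathbf{T}$ a tree poset and $r\in\mathbf{T}$. Tree notation. Let $\mathbf{T}$ be a tree poset and $w\in\mathbf{T}$. Each $t\ne w$ is joined to $w$ by a unique path in the cover graph. $\mathbf{U}_w$ (resp. $\mathbf{D}_w$) is the set of $t\in\mathbf{T}\setminus\{w\}$ for which the path from $w$ to $t$ starts with a step to an element greater (resp. smaller) than $w$. Put $\mathbf{U}_w^+=\{t\in\mathbf{U}_w: t>w\}$, $\mathbf{U}_w^-=\mathbf{U}_w\setminus\mathbf{U}_w^+$, $\mathbf{D}_w^-=\{t\in\mathbf{D}_w: t<w\}$, $\mathbf{D}_w^+=\mathbf{D}_w\setminus\mathbf{D}_w^-$. Admissible words at $w$ in $\mathbf{T}$ are: linear extensions $U_w^-,U_w^+$ of $\mathbf{U}_w^-,\mathbf{U}_w^+$ and $U_{w,1},U_{w,2}$ of $\mathbf{U}_w$ such that $U_w^-\,w\,U_w^+$, $w\,U_{w,1}$, $w\,U_{w,2}$ form a realizer of $\mathbf{U}_w\cup\{w\}$;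 and linear extensions $D_w^-,D_w^+$ of $\mathbf{D}_w^-,\mathbf{D}_w^+$ and $D_{w,1},D_{w,2}$ of $\mathbf{D}_w$ such that $D_w^-\,w\,D_w^+$, $D_{w,1}\,w$, $D_{w,2}\,w$ form a realizer of $\mathbf{D}_w\cup\{w\}$. (Admissible words always exist.) Cycle posets. The crown $\mathscr{C}_2$ has elements $x_1,x_2,z_1,z_2$ and strict relations exactly $x_i<z_j$ for all $i,j\in\{1,2\}$. A cycle poset $\mathbf{C}_2$ with underlying crown $\mathscr{C}_2$ is obtained by replacing, for each $p\in\{1,2,3,4\}$, the cover $x_{\lfloor p/2\rfloor+1}\lessdot z_{\lceil p/2\rceil}$ (indices mod $2$; so $p=1,2,3,4$ correspond to $x_1\lessdot z_1$, $x_2\lessdot z_1$, $x_2\lessdot z_2$, $x_1\lessdot z_2$) by a saturated chain $x_{\lfloor p/2\rfloor+1}\lessdot y^p_1\lessdot\cdots\lessdot y^p_{k_p}\lessdot z_{\lceil p/2\rceil}$ with $k_p\ge0$ new elements. Grafting. Given a family $\{(\mathbf{T}_v,r_v)\mid v\in Q\}$ of rooted tree posets indexed by a poset $Q$, the grafting on $Q$ is the poset on $\{(v,t): v\in Q, t\in\mathbf{T}_v\}$ with $(a,b)\le(c,d)$ iff either $a=c$ and $b\le d$ in $\mathbf{T}_a$, or $a<c$ in $Q$, $b\le r_a$ in $\mathbf{T}_a$ and $r_c\le d$ in $\mathbf{T}_c$. We identify $v$ with $(v,r_v)$ and $\mathbf{T}_v$ with $\{v\}\times\mathbf{T}_v$,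 so that $v$ is the root of $\mathbf{T}_v$. Words. For every $v\in\mathbf{C}_2$ fix admissible words at $v$ in $\mathbf{T}_v$. For $w\in\{x_i,z_i\}$ put $I_w^-=U_w^-\,D_{w,1}$ and $I_w^+=U_{w,1}\,D_w^+$; put $X_i^+=x_i\,U_{x_i}^+$, $X_i^-=D_{x_i}^-\,x_i$, $X_i^\bullet=D_{x_i,2}\,x_i\,U_{x_i,2}$, and likewise $Z_i^+=z_i\,U_{z_i}^+$, $Z_i^-=D_{z_i}^-\,z_i$, $Z_i^\bullet=D_{z_i,2}\,z_i\,U_{z_i,2}$. For $p\in\{1,2,3,4\}$ and any word $X$ put $$A_p(X)=\prod^{\searrow}_{1\le j\le k_p}\big(U_{y_j^p}^-\,D_{y_j^p,1}\big)\;X\;\prod^{\nearrow}_{1\le j\le k_p}\big(y_j^p\,U_{y_j^p}^+\big),$$ $$B_p(X)=\prod^{\nearrow}_{1\le j\le k_p}\big(D_{y_j^p}^-\,y_j^p\big)\;X\;\prod^{\searrow}_{1\le j\le k_p}\big(U_{y_j^p,1}\,D_{y_j^p}^+\big),$$ $$C_p=\prod^{\nearrow}_{1\le j\le k_p}\big(D_{y_j^p,2}\,y_j^p\,U_{y_j^p,2}\big),$$ and $A_j^i(X)=A_i(A_j(X))$, $B_j^i(X)=B_i(B_j(X))$. *)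

theory Defs
  imports Main
begin

section \<open>Posets, words and realizers\<close>

text \<open>A poset is a relation \<open>P\<close> satisfying \<^const>\<open>Partial_order\<close>, with elements
  \<^term>\<open>Field P\<close>; \<^term>\<open>(u, v) \<in> P\<close> means \<open>u \<le> v\<close>.  The subposet induced on
  \<open>A\<close> is \<^term>\<open>Restr P A\<close>.\<close>

definition word_order :: "'a list \<Rightarrow> 'a rel" where
  "word_order w = {(w ! i, w ! j) | i j. i \<le> j \<and> j < length w}"

definition linear_extension :: "'a rel \<Rightarrow> 'a list \<Rightarrow> bool" where
  "linear_extension P w \<longleftrightarrow> distinct w \<and> set w = Field P \<and> P \<subseteq> word_order w"

definition realizer :: "'a rel \<Rightarrow> 'a list list \<Rightarrow> bool" where
  "realizer P ws \<longleftrightarrow>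
     (\<forall>w \<in> set ws. linear_extension P w) \<and>
     (\<forall>u \<in> Field P. \<forall>v \<in> Field P. (u, v) \<in> P \<longleftrightarrow> (\<forall>w \<in> set ws. (u, v) \<in> word_order w))"


section \<open>Tree posets\<close>

definition covers :: "'a rel \<Rightarrow> 'a rel" where
  "covers P = {(u, v). (u, v) \<in> P \<and> u \<noteq> v \<and>
     \<not> (\<exists>w. w \<noteq> u \<and> w \<noteq> v \<and> (u, w) \<in> P \<and> (w, v) \<in> P)}"

definition cover_graph :: "'a rel \<Rightarrow> 'a rel" where
  "cover_graph P = covers P \<union> (covers P)\<inverse>"

text \<open>Simple graphs are given by a vertex set \<open>V\<close> and a symmetric irreflexive adjacency
  relation \<open>G\<close>; paths and cycles are lists of pairwise distinct vertices.\<close>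

definition graph_path :: "'a rel \<Rightarrow> 'a list \<Rightarrow> bool" where
  "graph_path G ps \<longleftrightarrow> ps \<noteq> [] \<and> distinct ps \<and> successively (\<lambda>u v. (u, v) \<in> G) ps"

definition graph_cycle :: "'a rel \<Rightarrow> 'a list \<Rightarrow> bool" where
  "graph_cycle G ps \<longleftrightarrow> graph_path G ps \<and> 3 \<le> length ps \<and> (last ps, hd ps) \<in> G"

definition is_tree :: "'a set \<Rightarrow> 'a rel \<Rightarrow> bool" where
  "is_tree V G \<longleftrightarrow> V \<noteq> {} \<and> (\<forall>u \<in> V. \<forall>v \<in> V. (u, v) \<in> G\<^sup>*) \<and> \<not> (\<exists>ps. graph_cycle G ps)"

definition tree_poset :: "'a rel \<Rightarrow> bool" where
  "tree_poset T \<longleftrightarrow> finite (Field T) \<and> Partial_order T \<and> is_tree (Field T) (cover_graph T)"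

definition rooted_tree_poset :: "'a rel \<Rightarrow> 'a \<Rightarrow> bool" where
  "rooted_tree_poset T r \<longleftrightarrow> tree_poset T \<and> r \<in> Field T"

definition U_set :: "'a rel \<Rightarrow> 'a \<Rightarrow> 'a set" where
  "U_set T w = {t \<in> Field T - {w}. \<exists>s ps. graph_path (cover_graph T) (w # s # ps) \<and>
     last (w # s # ps) = t \<and> (w, s) \<in> T}"

definition D_set :: "'a rel \<Rightarrow> 'a \<Rightarrow> 'a set" where
  "D_set T w = {t \<in> Field T - {w}. \<exists>s ps. graph_path (cover_graph T) (w # s # ps) \<and>
     last (w # s # ps) = t \<and> (s, w) \<in> T}"

definition U_set_plus :: "'a rel \<Rightarrow> 'a \<Rightarrow> 'a set" where
  "U_set_plus T w = {t \<in> U_set T w. (w, t) \<in> T}"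

definition U_set_minus :: "'a rel \<Rightarrow> 'a \<Rightarrow> 'a set" where
  "U_set_minus T w = U_set T w - U_set_plus T w"

definition D_set_minus :: "'a rel \<Rightarrow> 'a \<Rightarrow> 'a set" where
  "D_set_minus T w = {t \<in> D_set T w. (t, w) \<in> T}"

definition D_set_plus :: "'a rel \<Rightarrow> 'a \<Rightarrow> 'a set" where
  "D_set_plus T w = D_set T w - D_set_minus T w"


section \<open>Admissible words\<close>

text \<open>The fields are the words $U_w^-$, $U_w^+$, $U_{w,1}$, $U_{w,2}$, $D_w^-$, $D_w^+$,
  $D_{w,1}$, $D_{w,2}$, in this order.\<close>

record 'a words =
  Um :: "'a list"
  Up :: "'a list"
  U1 :: "'a list"
  U2 :: "'a list"
  Dm :: "'a list"
  Dp :: "'a list"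
  D1 :: "'a list"
  D2 :: "'a list"

definition admissible :: "'a rel \<Rightarrow> 'a \<Rightarrow> 'a words \<Rightarrow> bool" where
  "admissible T w W \<longleftrightarrow>
     linear_extension (Restr T (U_set_minus T w)) (Um W) \<and>
     linear_extension (Restr T (U_set_plus T w)) (Up W) \<and>
     linear_extension (Restr T (U_set T w)) (U1 W) \<and>
     linear_extension (Restr T (U_set T w)) (U2 W) \<and>
     realizer (Restr T (U_set T w \<union> {w})) [Um W @ [w] @ Up W, [w] @ U1 W, [w] @ U2 W] \<and>
     linear_extension (Restr T (D_set_minus T w)) (Dm W) \<and>
     linear_extension (Restr T (D_set_plus T w)) (Dp W) \<and>
     linear_extension (Restr T (D_set T w)) (D1 W) \<and>
     linear_extension (Restr T (D_set T w)) (D2 W) \<and>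
     realizer (Restr T (D_set T w \<union> {w})) [Dm W @ [w] @ Dp W, D1 W @ [w], D2 W @ [w]]"


section \<open>Cycle posets over the crown on \<open>x\<^sub>1, x\<^sub>2, z\<^sub>1, z\<^sub>2\<close>\<close>

text \<open>\<open>X i\<close>, \<open>Z i\<close> and \<open>Y p j\<close> stand for $x_i$, $z_i$ and $y^p_j$.  Only
  \<open>i \<in> {1, 2}\<close>, \<open>p \<in> {1, 2, 3, 4}\<close> and \<open>1 \<le> j \<le> k p\<close> occur in \<open>cycle_poset k\<close>.\<close>

datatype cycle_elem = X nat | Z nat | Y nat nat

text \<open>The chain replacing the \<open>p\<close>-th cover of the crown: its lower end is
  $x_{\lfloor p/2\rfloor+1}$ with the index read modulo 2 in \<open>{1, 2}\<close> (so \<open>p = 4\<close>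
  gives $x_1$), its upper end is $z_{\lceil p/2\rceil}$.\<close>

definition cycle_chain :: "(nat \<Rightarrow> nat) \<Rightarrow> nat \<Rightarrow> cycle_elem list" where
  "cycle_chain k p =
     [X (p div 2 mod 2 + 1)] @ map (Y p) [1..<k p + 1] @ [Z ((p + 1) div 2)]"

definition cycle_carrier :: "(nat \<Rightarrow> nat) \<Rightarrow> cycle_elem set" where
  "cycle_carrier k = (\<Union>p \<in> {1..4}. set (cycle_chain k p))"

definition cycle_covers :: "(nat \<Rightarrow> nat) \<Rightarrow> cycle_elem rel" where
  "cycle_covers k = (\<Union>p \<in> {1..4}. set (zip (cycle_chain k p) (tl (cycle_chain k p))))"

definition cycle_poset :: "(nat \<Rightarrow> nat) \<Rightarrow> cycle_elem rel" where
  "cycle_poset k = Restr ((cycle_covers k)\<^sup>*) (cycle_carrier k)"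


section \<open>Grafting\<close>

definition grafting :: "'v rel \<Rightarrow> ('v \<Rightarrow> 'a rel) \<Rightarrow> ('v \<Rightarrow> 'a) \<Rightarrow> ('v \<times> 'a) rel" where
  "grafting Q T r = {((a, b), (c, d)) | a b c d. a \<in> Field Q \<and> c \<in> Field Q \<and>
     (a = c \<and> (b, d) \<in> T a \<or>
      a \<noteq> c \<and> (a, c) \<in> Q \<and> (b, r a) \<in> T a \<and> (r c, d) \<in> T c)}"


section \<open>The building blocks of the three linear orders\<close>

text \<open>The words \<open>W v\<close> live on the elements of \<open>T v\<close>; \<^term>\<open>map (Pair v)\<close> carries them
  to the copy of \<open>T v\<close> inside the grafting.  \<open>V_plus\<close>, \<open>V_minus\<close> and
  \<open>V_bullet\<close> give $X_i^+$, $X_i^-$, $X_i^\bullet$ at $x_i$ and $Z_i^+$, $Z_i^-$,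
  $Z_i^\bullet$ at $z_i$; the same words occur at the $y^p_j$.\<close>

definition I_minus :: "('v \<Rightarrow> 'a words) \<Rightarrow> 'v \<Rightarrow> ('v \<times> 'a) list" where
  "I_minus W v = map (Pair v) (Um (W v) @ D1 (W v))"

definition I_plus :: "('v \<Rightarrow> 'a words) \<Rightarrow> 'v \<Rightarrow> ('v \<times> 'a) list" where
  "I_plus W v = map (Pair v) (U1 (W v) @ Dp (W v))"

definition V_plus :: "('v \<Rightarrow> 'a) \<Rightarrow> ('v \<Rightarrow> 'a words) \<Rightarrow> 'v \<Rightarrow> ('v \<times> 'a) list" where
  "V_plus r W v = map (Pair v) ([r v] @ Up (W v))"

definition V_minus :: "('v \<Rightarrow> 'a) \<Rightarrow> ('v \<Rightarrow> 'a words) \<Rightarrow> 'v \<Rightarrow> ('v \<times> 'a) list" where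
  "V_minus r W v = map (Pair v) (Dm (W v) @ [r v])"

definition V_bullet :: "('v \<Rightarrow> 'a) \<Rightarrow> ('v \<Rightarrow> 'a words) \<Rightarrow> 'v \<Rightarrow> ('v \<times> 'a) list" where
  "V_bullet r W v = map (Pair v) (D2 (W v) @ [r v] @ U2 (W v))"

definition prod_up :: "nat \<Rightarrow> nat \<Rightarrow> (nat \<Rightarrow> 'b list) \<Rightarrow> 'b list" where
  "prod_up a b f = concat (map f [a..<b + 1])"

definition prod_down :: "nat \<Rightarrow> nat \<Rightarrow> (nat \<Rightarrow> 'b list) \<Rightarrow> 'b list" where
  "prod_down a b f = concat (map f (rev [a..<b + 1]))"

definition A_word :: "(nat \<Rightarrow> nat) \<Rightarrow> (cycle_elem \<Rightarrow> 'a) \<Rightarrow> (cycle_elem \<Rightarrow> 'a words) \<Rightarrow> nat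
    \<Rightarrow> (cycle_elem \<times> 'a) list \<Rightarrow> (cycle_elem \<times> 'a) list" where
  "A_word k r W p w =
     prod_down 1 (k p) (\<lambda>j. I_minus W (Y p j)) @ w @
     prod_up 1 (k p) (\<lambda>j. V_plus r W (Y p j))"

definition B_word :: "(nat \<Rightarrow> nat) \<Rightarrow> (cycle_elem \<Rightarrow> 'a) \<Rightarrow> (cycle_elem \<Rightarrow> 'a words) \<Rightarrow> nat
    \<Rightarrow> (cycle_elem \<times> 'a) list \<Rightarrow> (cycle_elem \<times> 'a) list" where
  "B_word k r W p w =
     prod_up 1 (k p) (\<lambda>j. V_minus r W (Y p j)) @ w @
     prod_down 1 (k p) (\<lambda>j. I_plus W (Y p j))"

definition C_word :: "(nat \<Rightarrow> nat) \<Rightarrow> (cycle_elem \<Rightarrow> 'a) \<Rightarrow> (cycle_elem \<Rightarrow> 'a words) \<Rightarrow> nat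
    \<Rightarrow> (cycle_elem \<times> 'a) list" where
  "C_word k r W p = prod_up 1 (k p) (\<lambda>j. V_bullet r W (Y p j))"

end

theory Submission
  imports Defs
begin

text \<open>Cut a tree $T_v$ at its root into the sides \<open>U\<close> and \<open>D\<close>.  In the cover graph the root
  separates the two sides, so a comparability between them passes through the root
  (\<open>D_set_le_U_set\<close>), and the admissible words of the two sides combine to the three words
  \<open>form_A\<close>, \<open>form_B\<close>, \<open>form_C\<close> that realize the whole tree (\<open>realizer_rooted_tree\<close>).  Each of
  the three linear orders on the grafting induces one of these words on every tree, and a
  different one in each order, so pairs within a tree are settled.

  Pairs from two different trees depend only on the positions of a few blocks: form A is cut into
  $I^-$, which contains everything that is not at least the root, and the rest; form B is cut into
  $I^+$, which contains everything that is not at most the root, and the rest; form C is not cut.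
  The lemma \<open>realizer_grafting\<close> states four conditions on arrangements of such blocks under which
  the resulting words realize the grafting: the roots are in order; trees at incomparable indices
  are separated in both directions and trees at comparable indices in their order; for \<open>v < v'\<close>,
  the block $I^-$ of \<open>v'\<close> precedes the whole tree at \<open>v\<close> in some word, and the block $I^+$ of \<open>v\<close>
  follows the whole tree at \<open>v'\<close> in some word.

  What remains is a finite check on the cycle.  Its order is the union of its four
  chains (\<open>cycle_poset_eq\<close>), and the conditions are verified for each pair of kinds of elements,
  uniformly in the positions on the chains (\<open>order_early\<close>, \<open>order_late\<close>, \<open>order_separated\<close> and the
  lemmas on roots).\<close>

section \<open>Words and realizers\<close>

lemma word_order_Nil [simp]: "word_order [] = {}"
  by (simp add: word_order_def)

lemma word_order_Cons [simp]:
  "word_order (x # xs) = {x} \<times> insert x (set xs) \<union> word_order xs"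
proof (intro set_eqI iffI)
  fix p assume "p \<in> word_order (x # xs)"
  then obtain i j where p: "p = ((x # xs) ! i, (x # xs) ! j)" "i \<le> j" "j < Suc (length xs)"
    by (auto simp: word_order_def)
  show "p \<in> {x} \<times> insert x (set xs) \<union> word_order xs"
  proof (cases i)
    case 0
    then show ?thesis using p nth_mem[of j "x # xs"] by auto
  next
    case (Suc i')
    then obtain j' where "j = Suc j'" using p by (cases j) auto
    then show ?thesis using p Suc by (auto simp: word_order_def)
  qed
next
  fix p assume "p \<in> {x} \<times> insert x (set xs) \<union> word_order xs"
  then consider y where "p = (x, y)" "y \<in> set (x # xs)" | "p \<in> word_order xs" by auto
  then show "p \<in> word_order (x # xs)"
  proof cases
    case 1
    then obtain j where "y = (x # xs) ! j" "j < length (x # xs)" by (metis in_set_conv_nth)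
    then have "p = ((x # xs) ! 0, (x # xs) ! j) \<and> 0 \<le> j \<and> j < length (x # xs)"
      using 1 by simp
    then show ?thesis unfolding word_order_def by blast
  next
    case 2
    then obtain i j where "p = (xs ! i, xs ! j)" "i \<le> j" "j < length xs"
      by (auto simp: word_order_def)
    then have "p = ((x # xs) ! Suc i, (x # xs) ! Suc j) \<and> Suc i \<le> Suc j
      \<and> Suc j < length (x # xs)" by simp
    then show ?thesis unfolding word_order_def by blast
  qed
qed

lemma word_order_append [simp]:
  "word_order (xs @ ys) = word_order xs \<union> set xs \<times> set ys \<union> word_order ys"
  by (induction xs) auto

lemma word_order_in_set: "(x, y) \<in> word_order xs \<Longrightarrow> x \<in> set xs \<and> y \<in> set xs"
  by (induction xs) auto

lemma word_order_refl: "x \<in> set xs \<Longrightarrow> (x, x) \<in> word_order xs"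
  by (induction xs) auto

lemma word_order_antisym:
  "distinct xs \<Longrightarrow> (x, y) \<in> word_order xs \<Longrightarrow> (y, x) \<in> word_order xs \<Longrightarrow> x = y"
  by (induction xs) (auto dest: word_order_in_set)

lemma word_order_trans:
  "distinct xs \<Longrightarrow> (x, y) \<in> word_order xs \<Longrightarrow> (y, z) \<in> word_order xs \<Longrightarrow> (x, z) \<in> word_order xs"
  by (induction xs) (auto dest: word_order_in_set)

lemma word_order_total:
  "x \<in> set xs \<Longrightarrow> y \<in> set xs \<Longrightarrow> (x, y) \<in> word_order xs \<or> (y, x) \<in> word_order xs"
  by (induction xs) auto

lemma word_order_map: "word_order (map f xs) = map_prod f f ` word_order xs"
  by (induction xs) auto

lemma word_order_rev: "word_order (rev xs) = (word_order xs)\<inverse>"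
  by (induction xs) auto

lemma word_order_upt: "word_order [a..<b] = {(i, j). a \<le> i \<and> i \<le> j \<and> j < b}"
proof (induction b)
  case (Suc b)
  show ?case
  proof (cases "a \<le> b")
    case True
    then have "word_order [a..<Suc b] = word_order [a..<b] \<union> {a..b} \<times> {b}" by auto
    also have "\<dots> = {(i, j). a \<le> i \<and> i \<le> j \<and> j < Suc b}" unfolding Suc.IH by auto
    finally show ?thesis .
  qed auto
qed simp

lemma word_order_concat_map:
  "(b, c) \<in> word_order bs \<Longrightarrow> b \<noteq> c \<Longrightarrow> x \<in> set (f b) \<Longrightarrow> y \<in> set (f c) \<Longrightarrow>
    (x, y) \<in> word_order (concat (map f bs))"
  by (induction bs) auto

lemma word_order_concat_map_same:
  "b \<in> set bs \<Longrightarrow> (x, y) \<in> word_order (f b) \<Longrightarrow> (x, y) \<in> word_order (concat (map f bs))"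
  by (induction bs) auto

lemma distinct_concat_map:
  assumes "distinct bs" "\<And>b. b \<in> set bs \<Longrightarrow> distinct (f b)"
    and "\<And>b c. b \<in> set bs \<Longrightarrow> c \<in> set bs \<Longrightarrow> b \<noteq> c \<Longrightarrow> set (f b) \<inter> set (f c) = {}"
  shows "distinct (concat (map f bs))"
  using assms
proof (induction bs)
  case (Cons b bs)
  have "set (f b) \<inter> set (f c) = {}" if "c \<in> set bs" for c
    using Cons.prems(1) Cons.prems(3)[of b c] that by auto
  moreover have "distinct (concat (map f bs))" using Cons by simp
  ultimately show ?case using Cons.prems(2)[of b] by auto
qed simp

text \<open>Since words are total orders, a pair that is not related has to be
  exhibited only in the reversed order in one of the words.\<close>

lemma realizerI:
  assumes "\<And>w. w \<in> set ws \<Longrightarrow> linear_extension P w"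
    and "\<And>u v. u \<in> Field P \<Longrightarrow> v \<in> Field P \<Longrightarrow> (u, v) \<notin> P \<Longrightarrow>
      \<exists>w \<in> set ws. u \<noteq> v \<and> (v, u) \<in> word_order w"
  shows "realizer P ws"
  unfolding realizer_def
proof (intro conjI ballI iffI)
  fix u v assume uv: "u \<in> Field P" "v \<in> Field P"
  assume all: "\<forall>w \<in> set ws. (u, v) \<in> word_order w"
  show "(u, v) \<in> P"
  proof (rule ccontr)
    assume "(u, v) \<notin> P"
    then obtain w where "w \<in> set ws" "u \<noteq> v" "(v, u) \<in> word_order w" using assms(2) uv by blast
    then show False using all assms(1)[of w] word_order_antisym[of w u v]
      by (auto simp: linear_extension_def)
  qed
qed (use assms(1) in \<open>auto simp: linear_extension_def\<close>)

lemma realizer_reversed: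
  assumes "realizer P ws" "u \<in> Field P" "v \<in> Field P" "(u, v) \<notin> P"
  shows "\<exists>w \<in> set ws. (v, u) \<in> word_order w"
proof -
  obtain w where w: "w \<in> set ws" "(u, v) \<notin> word_order w" using assms by (auto simp: realizer_def)
  then have "set w = Field P" using assms(1) by (auto simp: realizer_def linear_extension_def)
  then show ?thesis using w word_order_total[of u w v] assms by auto
qed


section \<open>Tree posets seen from a root\<close>

lemma rtrancl_imp_graph_path:
  assumes "(a, b) \<in> G\<^sup>*"
  shows "\<exists>ps. graph_path G ps \<and> hd ps = a \<and> last ps = b"
  using assms
proof (induction rule: rtrancl_induct)
  case base
  have "graph_path G [a] \<and> hd [a] = a \<and> last [a] = a" by (simp add: graph_path_def)
  then show ?case by blast
next
  case (step b c)
  then obtain ps where ps: "graph_path G ps" "hd ps = a" "last ps = b" by blast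
  show ?case
  proof (cases "c \<in> set ps")
    case True
    then obtain qs rs where "ps = qs @ c # rs" by (meson split_list)
    then have ps': "ps = (qs @ [c]) @ rs" by simp
    then have "successively (\<lambda>u v. (u, v) \<in> G) (qs @ [c])"
      using ps(1) successively_append_iff[of _ "qs @ [c]" rs] unfolding graph_path_def by blast
    then have "graph_path G (qs @ [c]) \<and> hd (qs @ [c]) = a \<and> last (qs @ [c]) = c"
      using ps ps' by (cases qs) (simp_all add: graph_path_def)
    then show ?thesis by blast
  next
    case False
    then have "graph_path G (ps @ [c]) \<and> hd (ps @ [c]) = a \<and> last (ps @ [c]) = c"
      using ps step.hyps by (auto simp: graph_path_def successively_append_iff)
    then show ?thesis by blast
  qed
qed

lemma graph_path_imp_rtrancl: "graph_path G (a # ps) \<Longrightarrow> (a, last (a # ps)) \<in> G\<^sup>*"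
proof (induction ps arbitrary: a)
  case (Cons b ps)
  then have "(a, b) \<in> G" "graph_path G (b # ps)" by (auto simp: graph_path_def)
  then show ?case using Cons.IH[of b] by (simp add: converse_rtrancl_into_rtrancl)
qed simp

text \<open>Removing the root from the cover graph turns membership in \<open>U_set\<close> and \<open>D_set\<close>
  into reachability, for which no distinctness of vertices has to be tracked.\<close>

definition avoiding :: "'a rel \<Rightarrow> 'a \<Rightarrow> 'a rel" where
  "avoiding G w = {(a, b) \<in> G. a \<noteq> w \<and> b \<noteq> w}"

lemma avoiding_path_imp_path:
  assumes "(w, s) \<in> G" "s \<noteq> w" "(s, t) \<in> (avoiding G w)\<^sup>*"
  shows "\<exists>ps. graph_path G (w # s # ps) \<and> last (w # s # ps) = t"
proof -
  obtain qs where qs: "graph_path (avoiding G w) qs" "hd qs = s" "last qs = t"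
    using rtrancl_imp_graph_path[OF assms(3)] by blast
  then obtain ps where ps: "qs = s # ps" by (cases qs) (auto simp: graph_path_def)
  have path: "w \<notin> set (s # ps) \<and> successively (\<lambda>u v. (u, v) \<in> G) (s # ps)"
    if "successively (\<lambda>u v. (u, v) \<in> avoiding G w) (s # ps)" "s \<noteq> w" for s ps
    using that by (induction ps arbitrary: s) (auto simp: avoiding_def)
  have "graph_path G (w # s # ps)"
    using qs(1) path[OF _ assms(2), of ps] assms(1) unfolding ps graph_path_def by simp
  moreover have "last (w # s # ps) = t" using qs(3) ps by simp
  ultimately show ?thesis by blast
qed

lemma path_imp_avoiding_path:
  assumes "graph_path G (w # s # ps)"
  shows "(w, s) \<in> G" "s \<noteq> w" "(s, last (w # s # ps)) \<in> (avoiding G w)\<^sup>*"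
proof -
  show "(w, s) \<in> G" "s \<noteq> w" using assms by (auto simp: graph_path_def)
  have path: "successively (\<lambda>u v. (u, v) \<in> avoiding G w) (s # ps)"
    if "successively (\<lambda>u v. (u, v) \<in> G) (s # ps)" "w \<notin> set (s # ps)" for s ps
    using that by (induction ps arbitrary: s) (auto simp: avoiding_def)
  have "graph_path (avoiding G w) (s # ps)"
    using assms path[of s ps] unfolding graph_path_def by simp
  then have "(s, last (s # ps)) \<in> (avoiding G w)\<^sup>*" by (rule graph_path_imp_rtrancl)
  then show "(s, last (w # s # ps)) \<in> (avoiding G w)\<^sup>*" by simp
qed

lemma covers_imp: "(u, v) \<in> covers T \<Longrightarrow> (u, v) \<in> T \<and> u \<noteq> v"
  by (auto simp: covers_def)

lemma covers_converse: "covers (T\<inverse>) = (covers T)\<inverse>"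
  by (auto simp: covers_def)

lemma cover_graph_converse: "cover_graph (T\<inverse>) = cover_graph T"
  by (auto simp: cover_graph_def covers_converse)

lemma U_set_converse: "U_set (T\<inverse>) w = D_set T w"
  by (simp add: U_set_def D_set_def cover_graph_converse)

lemma rooted_tree_poset_converse: "rooted_tree_poset T w \<Longrightarrow> rooted_tree_poset (T\<inverse>) w"
  by (auto simp: rooted_tree_poset_def tree_poset_def cover_graph_converse partial_order_on_converse)

lemma cover_graph_Field: "(u, v) \<in> cover_graph T \<Longrightarrow> u \<in> Field T \<and> v \<in> Field T"
  by (auto simp: cover_graph_def covers_def Field_def)

lemma sym_avoiding_cover_graph: "sym ((avoiding (cover_graph T) w)\<^sup>*)"
  by (rule sym_rtrancl) (auto simp: sym_def avoiding_def cover_graph_def)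

lemma U_set_iff:
  "t \<in> U_set T w \<longleftrightarrow>
    (\<exists>s. (w, s) \<in> covers T \<and> t \<noteq> w \<and> (s, t) \<in> (avoiding (cover_graph T) w)\<^sup>*)"
  if "Partial_order T"
proof
  assume "t \<in> U_set T w"
  then obtain s ps where "graph_path (cover_graph T) (w # s # ps)" "last (w # s # ps) = t"
    and s: "(w, s) \<in> T" "t \<noteq> w" by (auto simp: U_set_def)
  from path_imp_avoiding_path[OF this(1)] this(2)
  have "(w, s) \<in> cover_graph T" "s \<noteq> w" "(s, t) \<in> (avoiding (cover_graph T) w)\<^sup>*" by auto
  moreover have "(w, s) \<in> covers T"
    using calculation s that antisymD[of T w s]
    by (auto simp: cover_graph_def partial_order_on_def dest: covers_imp)
  ultimately show "\<exists>s. (w, s) \<in> covers T \<and> t \<noteq> w \<and> (s, t) \<in> (avoiding (cover_graph T) w)\<^sup>*"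
    using s by blast
next
  assume "\<exists>s. (w, s) \<in> covers T \<and> t \<noteq> w \<and> (s, t) \<in> (avoiding (cover_graph T) w)\<^sup>*"
  then obtain s where s: "(w, s) \<in> covers T" "t \<noteq> w" 
    "(s, t) \<in> (avoiding (cover_graph T) w)\<^sup>*" by blast
  then have ws: "(w, s) \<in> cover_graph T" "s \<noteq> w" "(w, s) \<in> T"
    by (auto simp: cover_graph_def dest: covers_imp)
  have "t \<in> Field T" using s(3)
  proof (cases rule: rtranclE)
    case base then show ?thesis using ws cover_graph_Field by metis
  next
    case (step y) then show ?thesis using cover_graph_Field[of y t T] by (auto simp: avoiding_def)
  qed
  then show "t \<in> U_set T w"
    using avoiding_path_imp_path[OF ws(1,2) s(3)] s(2) ws(3) unfolding U_set_def by blast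
qed

lemma U_set_closed:
  "Partial_order T \<Longrightarrow> t \<in> U_set T w \<Longrightarrow> t' \<noteq> w \<Longrightarrow>
    (t, t') \<in> (avoiding (cover_graph T) w)\<^sup>* \<Longrightarrow> t' \<in> U_set T w"
  unfolding U_set_iff by (meson rtrancl_trans)

lemma D_set_closed:
  "Partial_order T \<Longrightarrow> t \<in> D_set T w \<Longrightarrow> t' \<noteq> w \<Longrightarrow>
    (t, t') \<in> (avoiding (cover_graph T) w)\<^sup>* \<Longrightarrow> t' \<in> D_set T w"
  using U_set_closed[of "T\<inverse>" t w t']
  by (simp add: U_set_converse cover_graph_converse partial_order_on_converse)

lemma Field_eq_insert_U_D:
  assumes "rooted_tree_poset T w"
  shows "Field T = insert w (U_set T w \<union> D_set T w)"
proof -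
  have "t \<in> U_set T w \<union> D_set T w" if t: "t \<in> Field T" "t \<noteq> w" for t
  proof -
    have "(w, t) \<in> (cover_graph T)\<^sup>*"
      using assms t by (auto simp: rooted_tree_poset_def tree_poset_def is_tree_def)
    then obtain qs where qs: "graph_path (cover_graph T) qs" "hd qs = w" "last qs = t"
      using rtrancl_imp_graph_path by metis
    then obtain s ps where ps: "qs = w # s # ps"
      using t(2) by (cases qs rule: remdups_adj.cases) (auto simp: graph_path_def)
    then have "(w, s) \<in> T \<or> (s, w) \<in> T"
      using qs by (auto simp: graph_path_def cover_graph_def covers_def)
    then show ?thesis using t qs unfolding ps U_set_def D_set_def by blast
  qed
  moreover have "w \<in> Field T" "U_set T w \<subseteq> Field T" "D_set T w \<subseteq> Field T"
    using assms by (auto simp: rooted_tree_poset_def U_set_def D_set_def)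
  ultimately show ?thesis by blast
qed

text \<open>A vertex reached both through an upper and a lower neighbour of the root would close a
  cycle through the root.\<close>

lemma U_D_disjoint:
  assumes "rooted_tree_poset T w"
  shows "U_set T w \<inter> D_set T w = {}"
proof (rule ccontr)
  let ?G = "cover_graph T"
  have po: "Partial_order T" and acyclic: "\<not> (\<exists>ps. graph_cycle ?G ps)"
    using assms by (auto simp: rooted_tree_poset_def tree_poset_def is_tree_def)
  assume "U_set T w \<inter> D_set T w \<noteq> {}"
  then obtain t where "t \<in> U_set T w" "t \<in> U_set (T\<inverse>) w" by (auto simp: U_set_converse)
  then obtain s s' where s: "(w, s) \<in> covers T" "(s, t) \<in> (avoiding ?G w)\<^sup>*"
    and s': "(s', w) \<in> covers T" "(s', t) \<in> (avoiding ?G w)\<^sup>*"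
    using po by (auto simp: U_set_iff partial_order_on_converse covers_converse cover_graph_converse)
  have "s \<noteq> s'" using s s' po antisymD[of T w s]
    by (auto simp: partial_order_on_def dest!: covers_imp)
  have "(s, s') \<in> (avoiding ?G w)\<^sup>*"
    using s s' sym_avoiding_cover_graph[of T w] by (meson rtrancl_trans symD)
  moreover have "(w, s) \<in> ?G" "s \<noteq> w" using s by (auto simp: cover_graph_def dest: covers_imp)
  ultimately obtain ps where ps: "graph_path ?G (w # s # ps)" "last (w # s # ps) = s'"
    using avoiding_path_imp_path by metis
  then have "ps \<noteq> []" using \<open>s \<noteq> s'\<close> by auto
  then have "graph_cycle ?G (w # s # ps)"
    using ps s' by (cases ps) (auto simp: graph_cycle_def cover_graph_def)
  then show False using acyclic by blast
qed

text \<open>Refining a relation \<open>a \<le> b\<close> to a saturated chain gives a path in the cover graph, and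
  this path meets \<open>w\<close> only if \<open>a \<le> w \<le> b\<close>.\<close>

lemma le_imp_avoiding:
  assumes po: "Partial_order T" and fin: "finite (Field T)"
  shows "(a, b) \<in> T \<Longrightarrow> \<not> ((a, w) \<in> T \<and> (w, b) \<in> T) \<Longrightarrow> a \<noteq> w \<Longrightarrow> b \<noteq> w \<Longrightarrow>
    (a, b) \<in> (avoiding (cover_graph T) w)\<^sup>*"
proof (induction "card {c. (a, c) \<in> T \<and> (c, b) \<in> T}" arbitrary: a b rule: less_induct)
  case less
  have tr: "(x, z) \<in> T" if "(x, y) \<in> T" "(y, z) \<in> T" for x y z
    using that po by (meson partial_order_on_def preorder_on_def transD)
  have an: "x = y" if "(x, y) \<in> T" "(y, x) \<in> T" for x y
    using that po by (meson partial_order_on_def antisymD)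
  have rf: "(x, x) \<in> T" if "x \<in> Field T" for x
    using that po by (meson partial_order_on_def preorder_on_def refl_onD)
  show ?case
  proof (cases "a = b \<or> (a, b) \<in> covers T")
    case True
    then show ?thesis using less.prems by (auto simp: avoiding_def cover_graph_def)
  next
    case False
    then obtain c where c: "c \<noteq> a" "c \<noteq> b" "(a, c) \<in> T" "(c, b) \<in> T"
      using less.prems by (auto simp: covers_def)
    have "{x. (a, x) \<in> T \<and> (x, b) \<in> T} \<subseteq> Field T" by (auto simp: Field_def)
    then have fin': "finite {x. (a, x) \<in> T \<and> (x, b) \<in> T}" using fin finite_subset by blast
    have ab: "a \<in> Field T" "b \<in> Field T" using less.prems(1) by (auto simp: Field_def)
    have "{x. (a, x) \<in> T \<and> (x, c) \<in> T} \<subset> {x. (a, x) \<in> T \<and> (x, b) \<in> T}"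
      using c tr an[of b c] rf[of b] less.prems(1) ab by blast
    moreover have "{x. (c, x) \<in> T \<and> (x, b) \<in> T} \<subset> {x. (a, x) \<in> T \<and> (x, b) \<in> T}"
      using c tr an[of a c] rf[of a] less.prems(1) ab by blast
    moreover have "c \<noteq> w" "\<not> ((a, w) \<in> T \<and> (w, c) \<in> T)" "\<not> ((c, w) \<in> T \<and> (w, b) \<in> T)"
      using less.prems(2) c tr by blast+
    ultimately show ?thesis
      using less.hyps[of a c] less.hyps[of c b] c less.prems(3,4) psubset_card_mono[OF fin']
      by (meson rtrancl_trans)
  qed
qed

text \<open>Elements above the root lie on its upper side: descend along a chain to a cover of the root;
  the chain cannot meet the root again.\<close>

lemma above_imp_U_set:
  assumes T: "rooted_tree_poset T w" and "(w, a) \<in> T" "a \<noteq> w"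
  shows "a \<in> U_set T w"
  using assms(2,3)
proof (induction "card {c. (w, c) \<in> T \<and> (c, a) \<in> T}" arbitrary: a rule: less_induct)
  case less
  have po: "Partial_order T" and fin: "finite (Field T)"
    using T by (auto simp: rooted_tree_poset_def tree_poset_def)
  have tr: "(x, z) \<in> T" if "(x, y) \<in> T" "(y, z) \<in> T" for x y z
    using that po by (meson partial_order_on_def preorder_on_def transD)
  have an: "x = y" if "(x, y) \<in> T" "(y, x) \<in> T" for x y
    using that po by (meson partial_order_on_def antisymD)
  show ?case
  proof (cases "(w, a) \<in> covers T")
    case True
    then show ?thesis using less.prems po by (auto simp: U_set_iff)
  next
    case False
    then obtain c where c: "c \<noteq> a" "c \<noteq> w" "(w, c) \<in> T" "(c, a) \<in> T"
      using less.prems by (auto simp: covers_def)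
    have "{x. (w, x) \<in> T \<and> (x, a) \<in> T} \<subseteq> Field T" by (auto simp: Field_def)
    then have fin': "finite {x. (w, x) \<in> T \<and> (x, a) \<in> T}" using fin finite_subset by blast
    have "(a, a) \<in> T" using po less.prems(1)
      by (metis FieldI2 partial_order_on_def preorder_on_def refl_onD)
    then have "{x. (w, x) \<in> T \<and> (x, c) \<in> T} \<subset> {x. (w, x) \<in> T \<and> (x, a) \<in> T}"
      using c tr an[of a c] less.prems(1) by blast
    then have "c \<in> U_set T w" using less.hyps[of c] c psubset_card_mono[OF fin'] by blast
    moreover have "\<not> ((c, w) \<in> T \<and> (w, a) \<in> T)" using c an by blast
    then have "(c, a) \<in> (avoiding (cover_graph T) w)\<^sup>*"
      using le_imp_avoiding[OF po fin] c less.prems by blast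
    ultimately show ?thesis using U_set_closed[OF po] less.prems by blast
  qed
qed

lemma below_imp_D_set:
  assumes "rooted_tree_poset T w" "(a, w) \<in> T" "a \<noteq> w"
  shows "a \<in> D_set T w"
  using above_imp_U_set[OF rooted_tree_poset_converse[OF assms(1)], of a] assms(2,3)
  by (simp add: U_set_converse)

text \<open>A comparability between the two sides that bypassed the root would connect them in the
  cover graph without the root.  So it passes through the root, which leaves only the
  relations \<open>d \<le> w \<le> u\<close>.\<close>

lemma U_set_not_le_D_set:
  assumes T: "rooted_tree_poset T w" and "u \<in> U_set T w" "d \<in> D_set T w"
  shows "(u, d) \<notin> T"
proof
  assume ud: "(u, d) \<in> T"
  have po: "Partial_order T" and fin: "finite (Field T)"
    using T by (auto simp: rooted_tree_poset_def tree_poset_def)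
  have ne: "u \<noteq> w" "d \<noteq> w" using assms by (auto simp: U_set_def D_set_def)
  have "\<not> (u, w) \<in> T" using below_imp_D_set[OF T] U_D_disjoint[OF T] assms ne by blast
  then have "d \<in> U_set T w"
    using U_set_closed[OF po assms(2) ne(2)] le_imp_avoiding[OF po fin ud] ne by blast
  then show False using U_D_disjoint[OF T] assms by blast
qed

lemma D_set_le_U_set:
  assumes T: "rooted_tree_poset T w" and "u \<in> U_set T w" "d \<in> D_set T w" and du: "(d, u) \<in> T"
  shows "(d, w) \<in> T \<and> (w, u) \<in> T"
proof (rule ccontr)
  assume neg: "\<not> ?thesis"
  have po: "Partial_order T" and fin: "finite (Field T)"
    using T by (auto simp: rooted_tree_poset_def tree_poset_def)
  have ne: "u \<noteq> w" "d \<noteq> w" using assms by (auto simp: U_set_def D_set_def)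
  have "u \<in> D_set T w"
    using D_set_closed[OF po assms(3) ne(1)] le_imp_avoiding[OF po fin du] neg ne by blast
  then show False using U_D_disjoint[OF T] assms by blast
qed

section \<open>Three words realizing a rooted tree poset\<close>

text \<open>Parentheses group the words as they are cut below: in a grafting, forms A and B occur with
  words on other trees inserted at the cut, while form C stays in one piece.\<close>

definition form_A :: "'a \<Rightarrow> 'a words \<Rightarrow> 'a list" where
  "form_A w W = (Um W @ D1 W) @ [w] @ Up W"

definition form_B :: "'a \<Rightarrow> 'a words \<Rightarrow> 'a list" where
  "form_B w W = (Dm W @ [w]) @ U1 W @ Dp W"

definition form_C :: "'a \<Rightarrow> 'a words \<Rightarrow> 'a list" where
  "form_C w W = D2 W @ [w] @ U2 W"

lemma linear_extension_Restr:
  assumes "linear_extension (Restr T A) xs" "Partial_order T" "A \<subseteq> Field T"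
  shows "distinct xs" "set xs = A"
    "\<And>a b. (a, b) \<in> T \<Longrightarrow> a \<in> A \<Longrightarrow> b \<in> A \<Longrightarrow> (a, b) \<in> word_order xs"
proof -
  have "Field (Restr T A) = A"
    using assms(2,3) by (auto simp: Field_def partial_order_on_def preorder_on_def refl_on_def)
  then show "distinct xs" "set xs = A"
    "\<And>a b. (a, b) \<in> T \<Longrightarrow> a \<in> A \<Longrightarrow> b \<in> A \<Longrightarrow> (a, b) \<in> word_order xs"
    using assms(1) by (auto simp: linear_extension_def)
qed

lemma realizer_Restr_reversed:
  assumes "realizer (Restr T A) ws" "Partial_order T" "A \<subseteq> Field T" "a \<in> A" "b \<in> A" "(a, b) \<notin> T"
  shows "\<exists>w \<in> set ws. (b, a) \<in> word_order w"
proof -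
  have "Field (Restr T A) = A"
    using assms(2,3) by (auto simp: Field_def partial_order_on_def preorder_on_def refl_on_def)
  then show ?thesis using realizer_reversed[OF assms(1)] assms by auto
qed

lemma admissible_Up: "admissible T w W \<Longrightarrow> a \<in> set (Up W) \<Longrightarrow> (w, a) \<in> T"
  by (auto simp: admissible_def linear_extension_def U_set_plus_def Field_def)

lemma admissible_Dm: "admissible T w W \<Longrightarrow> a \<in> set (Dm W) \<Longrightarrow> (a, w) \<in> T"
  by (auto simp: admissible_def linear_extension_def D_set_minus_def Field_def)

text \<open>Comparabilities between the upper and the lower side of the root are exactly those of
  \<open>D\<^sup>-\<close> with \<open>U\<^sup>+\<close>, and they hold in all three words.  A pair \<open>d \<in> D\<close>, \<open>u \<in> U\<close> is reversed in
  form A if \<open>u \<in> U\<^sup>-\<close> and in form B if \<open>d \<in> D\<^sup>+\<close>; form C keeps \<open>u\<close> from lying below \<open>d\<close>.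
  Inside one side, joined with the root, the three words restrict to the three words of
  the realizer that defines admissibility, up to the order in which they are listed.\<close>

lemma realizer_rooted_tree:
  assumes T: "rooted_tree_poset T w" and W: "admissible T w W"
  shows "realizer T [form_A w W, form_B w W, form_C w W]"
proof -
  have po: "Partial_order T" and w: "w \<in> Field T"
    using T by (auto simp: rooted_tree_poset_def tree_poset_def)
  have rf: "(x, x) \<in> T" if "x \<in> Field T" for x
    using that po by (meson partial_order_on_def preorder_on_def refl_onD)
  have tr: "(x, z) \<in> T" if "(x, y) \<in> T" "(y, z) \<in> T" for x y z
    using that po by (meson partial_order_on_def preorder_on_def transD)
  let ?U = "U_set T w" and ?D = "D_set T w"
  have fld: "Field T = insert w (?U \<union> ?D)" by (rule Field_eq_insert_U_D[OF T])
  have disj: "?U \<inter> ?D = {}" by (rule U_D_disjoint[OF T])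
  have wUD: "w \<notin> ?U" "w \<notin> ?D" by (auto simp: U_set_def D_set_def)
  let ?Up = "U_set_plus T w" and ?Um = "U_set_minus T w"
  let ?Dp = "D_set_plus T w" and ?Dm = "D_set_minus T w"
  have sub: "?Up \<subseteq> Field T" "?Um \<subseteq> Field T" "?Dp \<subseteq> Field T" "?Dm \<subseteq> Field T"
    "?U \<subseteq> Field T" "?D \<subseteq> Field T" "?U \<union> {w} \<subseteq> Field T" "?D \<union> {w} \<subseteq> Field T"
    using fld by (auto simp: U_set_plus_def U_set_minus_def D_set_plus_def D_set_minus_def)
  note le = linear_extension_Restr[OF _ po]
  have split: "?U = ?Um \<union> ?Up" "?Um \<inter> ?Up = {}" "?D = ?Dm \<union> ?Dp" "?Dm \<inter> ?Dp = {}"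
    by (auto simp: U_set_plus_def U_set_minus_def D_set_plus_def D_set_minus_def)
  have up: "(w, u) \<in> T \<longleftrightarrow> u = w \<or> u \<in> ?Up" for u
    using above_imp_U_set[OF T] rf[OF w] by (auto simp: U_set_plus_def)
  have dn: "(d, w) \<in> T \<longleftrightarrow> d = w \<or> d \<in> ?Dm" for d
    using below_imp_D_set[OF T] rf[OF w] by (auto simp: D_set_minus_def)
  have UD: "(u, d) \<notin> T" if "u \<in> ?U" "d \<in> ?D" for u d
    using U_set_not_le_D_set[OF T that] .
  have DU: "(d, u) \<in> T \<longleftrightarrow> d \<in> ?Dm \<and> u \<in> ?Up" if "u \<in> ?U" "d \<in> ?D" for u d
  proof
    assume "(d, u) \<in> T"
    then have "(d, w) \<in> T" "(w, u) \<in> T" using D_set_le_U_set[OF T that] by blast+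
    then show "d \<in> ?Dm \<and> u \<in> ?Up" using that by (simp add: D_set_minus_def U_set_plus_def)
  next
    assume "d \<in> ?Dm \<and> u \<in> ?Up"
    then show "(d, u) \<in> T" using tr[of d w u] by (simp add: D_set_minus_def U_set_plus_def)
  qed
  have upset: "b \<in> ?Up" if "(a, b) \<in> T" "a \<in> ?Up" "b \<in> ?U" for a b
    using that tr[of w a b] up[of a] up[of b] wUD by auto
  have downset: "a \<in> ?Dm" if "(a, b) \<in> T" "b \<in> ?Dm" "a \<in> ?D" for a b
    using that tr[of a b w] dn[of a] dn[of b] wUD by auto
  have Um: "linear_extension (Restr T ?Um) (Um W)" and Up: "linear_extension (Restr T ?Up) (Up W)"
    and U1: "linear_extension (Restr T ?U) (U1 W)" and U2: "linear_extension (Restr T ?U) (U2 W)"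
    and Dm: "linear_extension (Restr T ?Dm) (Dm W)" and Dp: "linear_extension (Restr T ?Dp) (Dp W)"
    and D1: "linear_extension (Restr T ?D) (D1 W)" and D2: "linear_extension (Restr T ?D) (D2 W)"
    and RU: "realizer (Restr T (?U \<union> {w})) [Um W @ [w] @ Up W, [w] @ U1 W, [w] @ U2 W]"
    and RD: "realizer (Restr T (?D \<union> {w})) [Dm W @ [w] @ Dp W, D1 W @ [w], D2 W @ [w]]"
    using W by (simp_all add: admissible_def)
  note sets [simp] = le(2)[OF Um sub(2)] le(2)[OF Up sub(1)] le(2)[OF U1 sub(5)] le(2)[OF U2 sub(5)]
    le(2)[OF Dm sub(4)] le(2)[OF Dp sub(3)] le(2)[OF D1 sub(6)] le(2)[OF D2 sub(6)]
  note dist [simp] = le(1)[OF Um sub(2)] le(1)[OF Up sub(1)] le(1)[OF U1 sub(5)] le(1)[OF U2 sub(5)]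
    le(1)[OF Dm sub(4)] le(1)[OF Dp sub(3)] le(1)[OF D1 sub(6)] le(1)[OF D2 sub(6)]
  note ord = le(3)[OF Um sub(2)] le(3)[OF Up sub(1)] le(3)[OF U1 sub(5)] le(3)[OF U2 sub(5)]
    le(3)[OF Dm sub(4)] le(3)[OF Dp sub(3)] le(3)[OF D1 sub(6)] le(3)[OF D2 sub(6)]
  have cases: "a = w \<or> a \<in> ?Um \<or> a \<in> ?Up \<or> a \<in> ?Dm \<or> a \<in> ?Dp" if "a \<in> Field T" for a
    using that fld split by blast
  show ?thesis
  proof (rule realizerI)
    fix xs assume "xs \<in> set [form_A w W, form_B w W, form_C w W]"
    then consider "xs = form_A w W" | "xs = form_B w W" | "xs = form_C w W" by auto
    then have "distinct xs \<and> set xs = Field T"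
      by cases (use disj split wUD fld in \<open>auto simp: form_A_def form_B_def form_C_def\<close>)
    moreover have "(a, b) \<in> word_order xs" if ab: "(a, b) \<in> T" for a b
    proof -
      have "a \<in> Field T" "b \<in> Field T" using ab by (auto simp: Field_def)
      then have c: "a = w \<or> a \<in> ?U \<or> a \<in> ?D" "b = w \<or> b \<in> ?U \<or> b \<in> ?D" using fld by auto
      consider "a = w" | "b = w" | "a \<in> ?U" "b \<in> ?U" | "a \<in> ?D" "b \<in> ?D" | "a \<in> ?Dm" "b \<in> ?Up"
        using c UD DU ab by blast
      then show ?thesis
      proof cases
        case 1
        then have "b = w \<or> b \<in> ?Up" using up ab by simp
        then show ?thesis using 1 split \<open>xs \<in> _\<close> by (auto simp: form_A_def form_B_def form_C_def)
      next
        case 2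
        then have "a = w \<or> a \<in> ?Dm" using dn ab by simp
        then show ?thesis using 2 split \<open>xs \<in> _\<close> by (auto simp: form_A_def form_B_def form_C_def)
      next
        case 3
        then have "a \<in> ?Um \<and> b \<in> ?Um \<or> a \<in> ?Um \<and> b \<in> ?Up \<or> a \<in> ?Up \<and> b \<in> ?Up"
          using upset ab split by blast
        then show ?thesis using 3 ord(1-4)[OF ab] \<open>xs \<in> _\<close>
          by (auto simp: form_A_def form_B_def form_C_def)
      next
        case 4
        then have "a \<in> ?Dm \<and> b \<in> ?Dm \<or> a \<in> ?Dm \<and> b \<in> ?Dp \<or> a \<in> ?Dp \<and> b \<in> ?Dp"
          using downset ab split by blast
        then show ?thesis using 4 ord(5-8)[OF ab] \<open>xs \<in> _\<close>
          by (auto simp: form_A_def form_B_def form_C_def)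
      next
        case 5
        then have "a \<in> ?D" "b \<in> ?U" using split by auto
        then show ?thesis using 5 \<open>xs \<in> _\<close> by (auto simp: form_A_def form_B_def form_C_def)
      qed
    qed
    ultimately show "linear_extension T xs" by (auto simp: linear_extension_def)
  next
    fix a b assume ab: "a \<in> Field T" "b \<in> Field T" "(a, b) \<notin> T"
    then have "a \<noteq> b" using rf by blast
    have c: "a = w \<or> a \<in> ?U \<or> a \<in> ?D" "b = w \<or> b \<in> ?U \<or> b \<in> ?D" using fld ab by auto
    have "(b, a) \<in> word_order (form_A w W) \<or> (b, a) \<in> word_order (form_B w W) \<or>
      (b, a) \<in> word_order (form_C w W)" (is ?rev)
    proof -
      consider "a \<in> ?U \<union> {w}" "b \<in> ?U \<union> {w}" | "a \<in> ?D \<union> {w}" "b \<in> ?D \<union> {w}"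
        | "a \<in> ?U" "b \<in> ?D" | "a \<in> ?D" "b \<in> ?U" using c by blast
      then show ?rev
      proof cases
        case 1
        then show ?thesis using realizer_Restr_reversed[OF RU po sub(7) 1 ab(3)] \<open>a \<noteq> b\<close> wUD
          by (auto simp: form_A_def form_B_def form_C_def dest: word_order_in_set)
      next
        case 2
        then show ?thesis using realizer_Restr_reversed[OF RD po sub(8) 2 ab(3)] \<open>a \<noteq> b\<close> wUD
          by (auto simp: form_A_def form_B_def form_C_def dest: word_order_in_set)
      next
        case 3
        then show ?thesis by (auto simp: form_C_def)
      next
        case 4
        then have "a \<in> ?Dp \<or> b \<in> ?Um" using DU ab split by blast
        then show ?thesis using 4 by (auto simp: form_A_def form_B_def)
      qed
    qed
    then show "\<exists>xs \<in> set [form_A w W, form_B w W, form_C w W]. a \<noteq> b \<and> (b, a) \<in> word_order xs"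
      using \<open>a \<noteq> b\<close> by auto
  qed
qed

section \<open>Words for graftings from orders of blocks\<close>

text \<open>The trees enter the words in five kinds of blocks, written $I^-$, $V^+$, $V^-$, $I^+$ and
  $V^\bullet$.  A list of pairs of a tree and a kind is an arrangement of blocks; replacing
  each pair by its block gives a word on the grafting.  Comparing elements of different
  trees then becomes comparing positions of blocks.\<close>

datatype part = Im | Vp | Vm | Ip | Vb

fun block :: "('v \<Rightarrow> 'a) \<Rightarrow> ('v \<Rightarrow> 'a words) \<Rightarrow> 'v \<times> part \<Rightarrow> ('v \<times> 'a) list" where
  "block r W (v, Im) = I_minus W v"
| "block r W (v, Vp) = V_plus r W v"
| "block r W (v, Vm) = V_minus r W v"
| "block r W (v, Ip) = I_plus W v"
| "block r W (v, Vb) = V_bullet r W v"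

definition block_word :: "('v \<Rightarrow> 'a) \<Rightarrow> ('v \<Rightarrow> 'a words) \<Rightarrow> ('v \<times> part) list \<Rightarrow> ('v \<times> 'a) list" where
  "block_word r W bs = concat (map (block r W) bs)"

definition has_form_A :: "('v \<times> part) list \<Rightarrow> 'v \<Rightarrow> bool" where
  "has_form_A bs v \<longleftrightarrow> (\<forall>p. (v, p) \<in> set bs \<longleftrightarrow> p \<in> {Im, Vp}) \<and> ((v, Im), (v, Vp)) \<in> word_order bs"

definition has_form_B :: "('v \<times> part) list \<Rightarrow> 'v \<Rightarrow> bool" where
  "has_form_B bs v \<longleftrightarrow> (\<forall>p. (v, p) \<in> set bs \<longleftrightarrow> p \<in> {Vm, Ip}) \<and> ((v, Vm), (v, Ip)) \<in> word_order bs"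

definition has_form_C :: "('v \<times> part) list \<Rightarrow> 'v \<Rightarrow> bool" where
  "has_form_C bs v \<longleftrightarrow> (\<forall>p. (v, p) \<in> set bs \<longleftrightarrow> p \<in> {Vb})"

lemma has_form_parts:
  "has_form_A bs v \<Longrightarrow> (v, p) \<in> set bs \<longleftrightarrow> p = Im \<or> p = Vp"
  "has_form_B bs v \<Longrightarrow> (v, p) \<in> set bs \<longleftrightarrow> p = Vm \<or> p = Ip"
  "has_form_C bs v \<Longrightarrow> (v, p) \<in> set bs \<longleftrightarrow> p = Vb"
  by (simp_all add: has_form_A_def has_form_B_def has_form_C_def)

definition before_all :: "('v \<times> part) list \<Rightarrow> 'v \<times> part \<Rightarrow> 'v \<Rightarrow> bool" where
  "before_all bs b v \<longleftrightarrow> b \<in> set bs \<and> (\<forall>q. (v, q) \<in> set bs \<longrightarrow> (b, (v, q)) \<in> word_order bs)"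

definition after_all :: "('v \<times> part) list \<Rightarrow> 'v \<times> part \<Rightarrow> 'v \<Rightarrow> bool" where
  "after_all bs b v \<longleftrightarrow> b \<in> set bs \<and> (\<forall>q. (v, q) \<in> set bs \<longrightarrow> ((v, q), b) \<in> word_order bs)"

lemma set_block_word: "set (block_word r W bs) = (\<Union>b \<in> set bs. set (block r W b))"
  by (simp add: block_word_def)

lemma fst_block: "x \<in> set (block r W (v, p)) \<Longrightarrow> fst x = v"
  by (cases p) (auto simp: I_minus_def I_plus_def V_plus_def V_minus_def V_bullet_def)

lemma root_block: "p \<in> {Vp, Vm, Vb} \<Longrightarrow> (v, r v) \<in> set (block r W (v, p))"
  by (auto simp: V_plus_def V_minus_def V_bullet_def)

lemma form_A_block: "map (Pair v) (form_A (r v) (W v)) = block r W (v, Im) @ block r W (v, Vp)"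
  by (simp add: form_A_def I_minus_def V_plus_def)

lemma form_B_block: "map (Pair v) (form_B (r v) (W v)) = block r W (v, Vm) @ block r W (v, Ip)"
  by (simp add: form_B_def I_plus_def V_minus_def)

lemma form_C_block: "map (Pair v) (form_C (r v) (W v)) = block r W (v, Vb)"
  by (simp add: form_C_def V_bullet_def)

lemma word_order_block_word:
  "(b, c) \<in> word_order bs \<Longrightarrow> b \<noteq> c \<Longrightarrow> x \<in> set (block r W b) \<Longrightarrow> y \<in> set (block r W c) \<Longrightarrow>
    (x, y) \<in> word_order (block_word r W bs)"
  unfolding block_word_def by (rule word_order_concat_map)

text \<open>Blocks of other trees between the two blocks of \<open>v\<close> do not affect the order that the
  word induces on the tree at \<open>v\<close>.\<close>

lemma word_order_form:
  "has_form_A bs v \<Longrightarrow> (a, b) \<in> word_order (form_A (r v) (W v)) \<Longrightarrow>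
    ((v, a), (v, b)) \<in> word_order (block_word r W bs)"
  "has_form_B bs v \<Longrightarrow> (a, b) \<in> word_order (form_B (r v) (W v)) \<Longrightarrow>
    ((v, a), (v, b)) \<in> word_order (block_word r W bs)"
  "has_form_C bs v \<Longrightarrow> (a, b) \<in> word_order (form_C (r v) (W v)) \<Longrightarrow>
    ((v, a), (v, b)) \<in> word_order (block_word r W bs)"
proof -
  have two: "((v, a), (v, b)) \<in> word_order (block_word r W bs)"
    if "map (Pair v) xs = block r W (v, p) @ block r W (v, q)" "(a, b) \<in> word_order xs" "p \<noteq> q"
      "((v, p), (v, q)) \<in> word_order bs" for xs p q
  proof -
    have "((v, a), (v, b)) \<in> word_order (block r W (v, p) @ block r W (v, q))"
      using that(2) unfolding that(1)[symmetric] word_order_map by force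
    then consider "((v, a), (v, b)) \<in> word_order (block r W (v, p))"
      | "((v, a), (v, b)) \<in> word_order (block r W (v, q))"
      | "(v, a) \<in> set (block r W (v, p))" "(v, b) \<in> set (block r W (v, q))" by auto
    then show ?thesis
    proof cases
      case 3
      then show ?thesis using word_order_block_word[OF that(4)] that(3) by auto
    qed (use that(4) word_order_in_set[OF that(4)] word_order_concat_map_same in
        \<open>auto simp: block_word_def\<close>)
  qed
  show "has_form_A bs v \<Longrightarrow> (a, b) \<in> word_order (form_A (r v) (W v)) \<Longrightarrow>
    ((v, a), (v, b)) \<in> word_order (block_word r W bs)"
    using two[OF form_A_block] by (auto simp: has_form_A_def)
  show "has_form_B bs v \<Longrightarrow> (a, b) \<in> word_order (form_B (r v) (W v)) \<Longrightarrow>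
    ((v, a), (v, b)) \<in> word_order (block_word r W bs)"
    using two[OF form_B_block] by (auto simp: has_form_B_def)
  assume "has_form_C bs v" "(a, b) \<in> word_order (form_C (r v) (W v))"
  then have "((v, a), (v, b)) \<in> word_order (block r W (v, Vb))" "(v, Vb) \<in> set bs"
    unfolding form_C_block[symmetric] word_order_map by (force, auto simp: has_form_C_def)
  then show "((v, a), (v, b)) \<in> word_order (block_word r W bs)" using word_order_concat_map_same unfolding block_word_def by metis
qed

text \<open>For \<open>v < v'\<close> in \<open>Q\<close>, an element \<open>a\<close> of the tree at \<open>v\<close> is below an element \<open>a'\<close> of the
  tree at \<open>v'\<close> only if \<open>a\<close> is at most the root of its tree and \<open>a'\<close> at least the root of its own.
  Such relations hold in a word as soon as the roots are in order, by transitivity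
  (\<open>roots\<close>).  All other pairs from two different trees have to be reversed in some word.  If
  \<open>v < v'\<close> fails, a word placing the whole tree at \<open>v'\<close> before the one at \<open>v\<close> does it (\<open>separated\<close>).
  If \<open>v < v'\<close>, either \<open>a\<close> is not at most its root, and then \<open>a\<close> lies in the block $I^+$ of \<open>v\<close>
  in a word where \<open>v\<close> has form B, so that it suffices to put this block late (\<open>late\<close>), or \<open>a'\<close> is
  not at least its root and lies in the block $I^-$ of \<open>v'\<close> in a word where \<open>v'\<close> has form A, and
  it suffices to put that block early (\<open>early\<close>).\<close>

lemma realizer_grafting:
  assumes trees: "\<And>v. v \<in> Field Q \<Longrightarrow> rooted_tree_poset (T v) (r v)"
    and words: "\<And>v. v \<in> Field Q \<Longrightarrow> admissible (T v) (r v) (W v)"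
    and dist: "\<And>bs. bs \<in> set bss \<Longrightarrow> distinct bs"
    and carrier: "\<And>bs. bs \<in> set bss \<Longrightarrow> fst ` set bs \<subseteq> Field Q"
    and forms: "\<And>bs v. bs \<in> set bss \<Longrightarrow> v \<in> Field Q \<Longrightarrow>
      has_form_A bs v \<or> has_form_B bs v \<or> has_form_C bs v"
    and all_forms: "\<And>v. v \<in> Field Q \<Longrightarrow>
      (\<exists>bs \<in> set bss. has_form_A bs v) \<and> (\<exists>bs \<in> set bss. has_form_B bs v) \<and>
      (\<exists>bs \<in> set bss. has_form_C bs v)"
    and roots: "\<And>bs v v' p q. bs \<in> set bss \<Longrightarrow> (v, v') \<in> Q \<Longrightarrow> v \<noteq> v' \<Longrightarrow>
      (v, p) \<in> set bs \<Longrightarrow> (v', q) \<in> set bs \<Longrightarrow> p \<in> {Vp, Vm, Vb} \<Longrightarrow> q \<in> {Vp, Vm, Vb} \<Longrightarrow>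
      ((v, p), (v', q)) \<in> word_order bs"
    and separated: "\<And>v v'. v \<in> Field Q \<Longrightarrow> v' \<in> Field Q \<Longrightarrow> (v, v') \<notin> Q \<Longrightarrow> v \<noteq> v' \<Longrightarrow>
      \<exists>bs \<in> set bss. \<forall>p. (v', p) \<in> set bs \<longrightarrow> before_all bs (v', p) v"
    and early: "\<And>v v'. (v, v') \<in> Q \<Longrightarrow> v \<noteq> v' \<Longrightarrow> \<exists>bs \<in> set bss. before_all bs (v', Im) v"
    and late: "\<And>v v'. (v, v') \<in> Q \<Longrightarrow> v \<noteq> v' \<Longrightarrow> \<exists>bs \<in> set bss. after_all bs (v, Ip) v'"
  shows "realizer (grafting Q T r) (map (block_word r W) bss)"
proof -
  have tree_po: "Partial_order (T v)" "r v \<in> Field (T v)" if "v \<in> Field Q" for v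
    using trees[OF that] by (auto simp: rooted_tree_poset_def tree_poset_def)
  have rf: "(a, a) \<in> T v" if "v \<in> Field Q" "a \<in> Field (T v)" for a v
    using that tree_po[of v] by (meson partial_order_on_def preorder_on_def refl_onD)
  have local: "realizer (T v) [form_A (r v) (W v), form_B (r v) (W v), form_C (r v) (W v)]"
    if "v \<in> Field Q" for v
    using realizer_rooted_tree[OF trees words] that by blast
  have word: "distinct (form_A (r v) (W v))" "set (form_A (r v) (W v)) = Field (T v)"
      "T v \<subseteq> word_order (form_A (r v) (W v))"
    "distinct (form_B (r v) (W v))" "set (form_B (r v) (W v)) = Field (T v)"
      "T v \<subseteq> word_order (form_B (r v) (W v))"
    "distinct (form_C (r v) (W v))" "set (form_C (r v) (W v)) = Field (T v)"
      "T v \<subseteq> word_order (form_C (r v) (W v))"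
    if "v \<in> Field Q" for v
    using local[OF that] by (auto simp: realizer_def linear_extension_def)
  have Field_graft: "Field (grafting Q T r) = Sigma Q' (\<lambda>v. Field (T v))" if "Q' = Field Q" for Q'
  proof
    show "Field (grafting Q T r) \<subseteq> Sigma Q' (\<lambda>v. Field (T v))"
      using that by (auto simp: grafting_def Field_def)
    show "Sigma Q' (\<lambda>v. Field (T v)) \<subseteq> Field (grafting Q T r)"
    proof clarify
      fix v a assume "v \<in> Q'" "a \<in> Field (T v)"
      then have "((v, a), (v, a)) \<in> grafting Q T r" using rf that by (auto simp: grafting_def)
      then show "(v, a) \<in> Field (grafting Q T r)" by (rule FieldI1)
    qed
  qed
  note Field_graft = Field_graft[OF refl]
  have in_block: "\<exists>p. (v, p) \<in> set bs \<and> (v, a) \<in> set (block r W (v, p))"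
    if "bs \<in> set bss" "v \<in> Field Q" "a \<in> Field (T v)" for bs v a
  proof -
    have "(v, a) \<in> set (map (Pair v) (form_A (r v) (W v)))"
      "(v, a) \<in> set (map (Pair v) (form_B (r v) (W v)))"
      "(v, a) \<in> set (map (Pair v) (form_C (r v) (W v)))" using that word by auto
    then show ?thesis using forms[OF that(1,2)]
      unfolding form_A_block form_B_block form_C_block has_form_A_def has_form_B_def has_form_C_def
      by (auto simp del: block.simps)
  qed
  have block_tree: "distinct (block r W (v, p)) \<and> set (block r W (v, p)) \<subseteq> {v} \<times> Field (T v)"
    if "v \<in> Field Q" for v p
  proof -
    have "distinct (map (Pair v) (form_A (r v) (W v)))" "distinct (map (Pair v) (form_B (r v) (W v)))"
      "distinct (map (Pair v) (form_C (r v) (W v)))"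
      "set (map (Pair v) (form_A (r v) (W v))) = {v} \<times> Field (T v)"
      "set (map (Pair v) (form_B (r v) (W v))) = {v} \<times> Field (T v)"
      "set (map (Pair v) (form_C (r v) (W v))) = {v} \<times> Field (T v)"
      using word[OF that] by (auto simp: distinct_map inj_on_def)
    then show ?thesis unfolding form_A_block form_B_block form_C_block
      by (cases p) (auto simp del: block.simps)
  qed
  have block_disj: "set (block r W (v, p)) \<inter> set (block r W (v, q)) = {}"
    if "bs \<in> set bss" "v \<in> Field Q" "(v, p) \<in> set bs" "(v, q) \<in> set bs" "p \<noteq> q" for bs v p q
  proof -
    have "distinct (map (Pair v) (form_A (r v) (W v)))" "distinct (map (Pair v) (form_B (r v) (W v)))"
      using word[OF that(2)] by (auto simp: distinct_map inj_on_def)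
    moreover have "p \<in> {Im, Vp} \<and> q \<in> {Im, Vp} \<or> p \<in> {Vm, Ip} \<and> q \<in> {Vm, Ip} \<or> p = q"
      using forms[OF that(1,2)] that(3,4) has_form_parts(1)[of bs v] has_form_parts(2)[of bs v]
        has_form_parts(3)[of bs v] by (elim disjE) simp_all
    ultimately show ?thesis using that(5) unfolding form_A_block form_B_block
      by (elim disjE) (simp_all only: distinct_append, blast+)
  qed
  show ?thesis
  proof (rule realizerI)
    fix w assume "w \<in> set (map (block_word r W) bss)"
    then obtain bs where bs: "bs \<in> set bss" and w: "w = block_word r W bs" by auto
    have "distinct w" unfolding w block_word_def
    proof (rule distinct_concat_map[OF dist[OF bs]])
      fix b assume b: "b \<in> set bs"
      obtain v p where vp: "b = (v, p)" by (cases b)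
      have v: "v \<in> Field Q" using b carrier[OF bs] vp by force
      show "distinct (block r W b)" using block_tree[OF v] vp by blast
      fix c assume c: "c \<in> set bs" "b \<noteq> c"
      obtain v' q where vq: "c = (v', q)" by (cases c)
      show "set (block r W b) \<inter> set (block r W c) = {}"
      proof (cases "v = v'")
        case True
        then show ?thesis using block_disj[OF bs v] b c vp vq by blast
      next
        case False
        then show ?thesis using fst_block[of _ r W v p] fst_block[of _ r W v' q]
          unfolding vp vq disjoint_iff by metis
      qed
    qed
    moreover have "set w = Field (grafting Q T r)"
    proof
      show "set w \<subseteq> Field (grafting Q T r)"
      proof
        fix x assume "x \<in> set w"
        then obtain v p where vp: "(v, p) \<in> set bs" "x \<in> set (block r W (v, p))"
          unfolding w set_block_word by fast
        then have "v \<in> Field Q" using carrier[OF bs] by force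
        then show "x \<in> Field (grafting Q T r)"
          using vp block_tree unfolding Field_graft by blast
      qed
      show "Field (grafting Q T r) \<subseteq> set w"
        using in_block[OF bs] unfolding w set_block_word Field_graft by blast
    qed
    moreover have "(x, y) \<in> word_order w" if "(x, y) \<in> grafting Q T r" for x y
    proof -
      obtain v a v' a' where xy: "x = (v, a)" "y = (v', a')" by (cases x, cases y)
      have vv: "v \<in> Field Q" "v' \<in> Field Q" using that xy by (auto simp: grafting_def)
      have same: "((u, b), (u, b')) \<in> word_order w" if "u \<in> Field Q" "(b, b') \<in> T u" for u b b'
        using forms[OF bs that(1)] word_order_form[of bs u b b' r W] word[OF that(1)] that(2)
        unfolding w by blast
      show ?thesis
      proof (cases "v = v'")
        case True
        then show ?thesis using that xy same[OF vv(1)] by (auto simp: grafting_def)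
      next
        case False
        then have le: "(v, v') \<in> Q" "(a, r v) \<in> T v" "(r v', a') \<in> T v'"
          using that xy by (auto simp: grafting_def)
        have root: "\<exists>p \<in> {Vp, Vm, Vb}. (u, p) \<in> set bs" if "u \<in> Field Q" for u
          using forms[OF bs that] unfolding has_form_A_def has_form_B_def has_form_C_def by blast
        obtain p where p: "p \<in> {Vp, Vm, Vb}" "(v, p) \<in> set bs" using root[OF vv(1)] by blast
        obtain q where q: "q \<in> {Vp, Vm, Vb}" "(v', q) \<in> set bs" using root[OF vv(2)] by blast
        have "((v, r v), (v', r v')) \<in> word_order w" unfolding w
        proof (rule word_order_block_word)
          show "((v, p), (v', q)) \<in> word_order bs"
            using roots[OF bs le(1) False p(2) q(2) p(1) q(1)] .
        qed (use False root_block[OF p(1)] root_block[OF q(1)] in simp_all)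
        then show ?thesis
          using same[OF vv(1) le(2)] same[OF vv(2) le(3)] word_order_trans[OF \<open>distinct w\<close>]
          unfolding xy by blast
      qed
    qed
    ultimately show "linear_extension (grafting Q T r) w" by (auto simp: linear_extension_def)
  next
    fix x y assume xy: "x \<in> Field (grafting Q T r)" "y \<in> Field (grafting Q T r)"
      "(x, y) \<notin> grafting Q T r"
    show "\<exists>w \<in> set (map (block_word r W) bss). x \<noteq> y \<and> (y, x) \<in> word_order w"
    proof -
      obtain v a v' a' where xy': "x = (v, a)" "y = (v', a')" by (cases x, cases y)
      have vv: "v \<in> Field Q" "v' \<in> Field Q" "a \<in> Field (T v)" "a' \<in> Field (T v')"
        using xy(1,2) unfolding xy' Field_graft by auto
      have "x \<noteq> y" using xy(3) rf[OF vv(1,3)] vv(1) unfolding xy' by (auto simp: grafting_def)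
      have blocks: "\<exists>bs \<in> set bss. (y, x) \<in> word_order (block_word r W bs)"
        if "v \<noteq> v'" "bs \<in> set bss" "((v', q), (v, p)) \<in> word_order bs"
          "y \<in> set (block r W (v', q))" "x \<in> set (block r W (v, p))" for bs p q
        using word_order_block_word[OF that(3) _ that(4,5)] that(1,2) by blast
      have "\<exists>bs \<in> set bss. (y, x) \<in> word_order (block_word r W bs)"
      proof -
        consider "v = v'" | "v \<noteq> v'" "(v, v') \<notin> Q" | "v \<noteq> v'" "(v, v') \<in> Q" by blast
        then show ?thesis
        proof cases
          case 1
          then have "(a, a') \<notin> T v" using xy(3) vv(1) unfolding xy' by (auto simp: grafting_def)
          then have "(a', a) \<in> word_order (form_A (r v) (W v)) \<or>
            (a', a) \<in> word_order (form_B (r v) (W v)) \<or> (a', a) \<in> word_order (form_C (r v) (W v))"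
            using realizer_reversed[OF local[OF vv(1)] vv(3)] vv(4) 1 by simp
          then show ?thesis using all_forms[OF vv(1)] word_order_form[of _ v a' a r W] 1
            unfolding xy' by blast
        next
          case 2
          then obtain bs where bs: "bs \<in> set bss"
            and all: "\<forall>q. (v', q) \<in> set bs \<longrightarrow> before_all bs (v', q) v"
            using separated[OF vv(1,2)] by blast
          obtain p where p: "(v, p) \<in> set bs" "x \<in> set (block r W (v, p))"
            using in_block[OF bs vv(1,3)] unfolding xy' by blast
          obtain q where q: "(v', q) \<in> set bs" "y \<in> set (block r W (v', q))"
            using in_block[OF bs vv(2,4)] unfolding xy' by blast
          have "((v', q), (v, p)) \<in> word_order bs" using all p q unfolding before_all_def by blast
          then show ?thesis using blocks 2 bs p q by blast
        next
          case 3
          then have "(a, r v) \<notin> T v \<or> (r v', a') \<notin> T v'"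
            using xy(3) vv unfolding xy' by (auto simp: grafting_def)
          then show ?thesis
          proof
            assume a: "(a, r v) \<notin> T v"
            obtain bs where bs: "bs \<in> set bss" and all: "after_all bs (v, Ip) v'"
              using late[OF 3(2,1)] by blast
            obtain p where p: "(v, p) \<in> set bs" "x \<in> set (block r W (v, p))"
              using in_block[OF bs vv(1,3)] unfolding xy' by blast
            have "(v, Ip) \<in> set bs" using all unfolding after_all_def by blast
            then have "p \<in> {Vm, Ip}" using forms[OF bs vv(1)] p(1)
              unfolding has_form_A_def has_form_B_def has_form_C_def by blast
            \<comment> \<open>The block \<open>Vm\<close> holds only elements at most the root.\<close>
            moreover have "p \<noteq> Vm"
            proof
              assume "p = Vm"
              then have "a \<in> set (Dm (W v)) \<or> a = r v" using p unfolding xy' by (auto simp: V_minus_def)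
              then show False using a admissible_Dm[OF words[OF vv(1)]] rf[OF vv(1) tree_po(2)[OF vv(1)]]
                by blast
            qed
            ultimately have Ip: "p = Ip" by blast
            obtain q where q: "(v', q) \<in> set bs" "y \<in> set (block r W (v', q))"
              using in_block[OF bs vv(2,4)] unfolding xy' by blast
            have "((v', q), (v, p)) \<in> word_order bs" using all q Ip unfolding after_all_def by blast
            then show ?thesis using blocks 3 bs p q by blast
          next
            assume a': "(r v', a') \<notin> T v'"
            obtain bs where bs: "bs \<in> set bss" and all: "before_all bs (v', Im) v"
              using early[OF 3(2,1)] by blast
            obtain q where q: "(v', q) \<in> set bs" "y \<in> set (block r W (v', q))"
              using in_block[OF bs vv(2,4)] unfolding xy' by blast
            have "(v', Im) \<in> set bs" using all unfolding before_all_def by blast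
            then have "q \<in> {Im, Vp}" using forms[OF bs vv(2)] q(1)
              unfolding has_form_A_def has_form_B_def has_form_C_def by blast
            \<comment> \<open>The block \<open>Vp\<close> holds only elements at least the root.\<close>
            moreover have "q \<noteq> Vp"
            proof
              assume "q = Vp"
              then have "a' \<in> set (Up (W v')) \<or> a' = r v'" using q unfolding xy' by (auto simp: V_plus_def)
              then show False using a' admissible_Up[OF words[OF vv(2)]] rf[OF vv(2) tree_po(2)[OF vv(2)]]
                by blast
            qed
            ultimately have Im: "q = Im" by blast
            obtain p where p: "(v, p) \<in> set bs" "x \<in> set (block r W (v, p))"
              using in_block[OF bs vv(1,3)] unfolding xy' by blast
            have "((v', q), (v, p)) \<in> word_order bs" using all p Im unfolding before_all_def by blast
            then show ?thesis using blocks 3 bs p q by blast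
          qed
        qed
      qed
      then show ?thesis using \<open>x \<noteq> y\<close> by auto
    qed
  qed
qed

section \<open>The order of a cycle poset\<close>

lemma word_order_subset_rtrancl: "word_order xs \<subseteq> (set (zip xs (tl xs)))\<^sup>*"
proof (induction xs)
  case (Cons x xs)
  show ?case
  proof (cases xs)
    case (Cons y ys)
    let ?R = "set (zip (x # xs) xs)"
    have sub: "(set (zip xs (tl xs)))\<^sup>* \<subseteq> ?R\<^sup>*" using Cons by (intro rtrancl_mono) auto
    have "(x, z) \<in> ?R\<^sup>*" if "z \<in> set xs" for z
    proof -
      have "(y, z) \<in> word_order xs" using that Cons by auto
      then have "(y, z) \<in> ?R\<^sup>*" using Cons.IH sub by blast
      moreover have "(x, y) \<in> ?R" using Cons by simp
      ultimately show ?thesis by (meson converse_rtrancl_into_rtrancl)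
    qed
    then show ?thesis using Cons.IH sub by auto
  qed simp
qed simp

lemma zip_tl_subset_word_order: "set (zip xs (tl xs)) \<subseteq> word_order xs"
proof (induction xs)
  case (Cons x xs)
  then show ?case by (cases xs) auto
qed simp

text \<open>Kept as a constant so that the interval \<open>[1..<n + 1]\<close> is not unrolled by the simplifier.\<close>

definition chain_map :: "(nat \<Rightarrow> 'b) \<Rightarrow> nat \<Rightarrow> 'b list" where
  "chain_map f n = map f [1..<n + 1]"

lemma set_chain_map: "set (chain_map f n) = {f j | j. 1 \<le> j \<and> j \<le> n}"
  unfolding chain_map_def set_map set_upt by force

lemma word_order_chain_map:
  "word_order (chain_map f n) = {(f i, f j) | i j. 1 \<le> i \<and> i \<le> j \<and> j \<le> n}"
  unfolding chain_map_def word_order_map word_order_upt by force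

lemma distinct_chain_map: "inj f \<Longrightarrow> distinct (chain_map f n)"
  unfolding chain_map_def by (simp add: distinct_map inj_on_def)

lemma cycle_chain_eq:
  "cycle_chain k p =
    [X (p div 2 mod 2 + 1)] @ chain_map (Y p) (k p) @ [Z ((p + 1) div 2)]"
  by (simp add: cycle_chain_def chain_map_def)

lemma word_order_cycle_chain:
  "word_order (cycle_chain k p) =
    word_order [X (p div 2 mod 2 + 1), Z ((p + 1) div 2)] \<union>
    {(X (p div 2 mod 2 + 1), Y p j) | j. 1 \<le> j \<and> j \<le> k p} \<union>
    {(Y p i, Y p j) | i j. 1 \<le> i \<and> i \<le> j \<and> j \<le> k p} \<union>
    {(Y p j, Z ((p + 1) div 2)) | j. 1 \<le> j \<and> j \<le> k p}"
  unfolding cycle_chain_eq word_order_append word_order_chain_map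
  by (auto simp: set_chain_map)

lemma set_cycle_chain:
  "set (cycle_chain k p) =
    {X (p div 2 mod 2 + 1), Z ((p + 1) div 2)} \<union> {Y p j | j. 1 \<le> j \<and> j \<le> k p}"
  unfolding cycle_chain_eq set_append set_chain_map by auto

lemma atLeastAtMost_1_4: "{1..4} = {1, 2, 3, 4 :: nat}"
  by auto

text \<open>Two different chains share at most a common lowest or a common highest element, so
  composing a relation of one chain with a relation of the other gives nothing new.\<close>

lemma cycle_poset_eq: "cycle_poset k = (\<Union>p \<in> {1..4}. word_order (cycle_chain k p))"
proof
  let ?E = "\<Union>p \<in> {1..4}. word_order (cycle_chain k p)"
  have trans: "(u, w) \<in> ?E" if uv: "(u, v) \<in> ?E" and vw: "(v, w) \<in> ?E" for u v w
  proof -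
    obtain p q where p: "p \<in> {1..4}" "(u, v) \<in> word_order (cycle_chain k p)"
      and q: "q \<in> {1..4}" "(v, w) \<in> word_order (cycle_chain k q)" using uv vw by blast
    have "(u, w) \<in> word_order (cycle_chain k p) \<or> u = v \<or> v = w"
      using p(2) q(2) unfolding word_order_cycle_chain by (cases v) auto
    then show ?thesis using p q uv vw by blast
  qed
  have "(u, v) \<in> ?E" if "(u, v) \<in> (cycle_covers k)\<^sup>*" "u \<in> cycle_carrier k" for u v
    using that
  proof (induction rule: rtrancl_induct)
    case base
    then obtain p where p: "p \<in> {1..4}" "u \<in> set (cycle_chain k p)"
      unfolding cycle_carrier_def by blast
    have "(u, u) \<in> word_order (cycle_chain k p)" using p(2) by (rule word_order_refl)
    then show ?case using p(1) by blast
  next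
    case (step v w)
    have "(v, w) \<in> ?E"
      using step.hyps(2) zip_tl_subset_word_order unfolding cycle_covers_def by blast
    then show ?case using trans step by blast
  qed
  then show "cycle_poset k \<subseteq> ?E" by (auto simp: cycle_poset_def)
  have "word_order (cycle_chain k p) \<subseteq> (cycle_covers k)\<^sup>*" if "p \<in> {1..4}" for p
  proof -
    have "set (zip (cycle_chain k p) (tl (cycle_chain k p))) \<subseteq> cycle_covers k"
      using that by (auto simp: cycle_covers_def)
    then show ?thesis using word_order_subset_rtrancl rtrancl_mono by blast
  qed
  then show "?E \<subseteq> cycle_poset k"
    using word_order_in_set unfolding cycle_poset_def cycle_carrier_def by fast
qed

lemma Field_cycle_poset:
  "Field (cycle_poset k) = {X 1, X 2, Z 1, Z 2} \<union> {Y p j | p j. p \<in> {1..4} \<and> 1 \<le> j \<and> j \<le> k p}"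
proof -
  have "Field (cycle_poset k) = (\<Union>p \<in> {1..4}. set (cycle_chain k p))"
  proof
    show "Field (cycle_poset k) \<subseteq> (\<Union>p \<in> {1..4}. set (cycle_chain k p))"
      using word_order_in_set unfolding cycle_poset_eq Field_def by fast
    show "(\<Union>p \<in> {1..4}. set (cycle_chain k p)) \<subseteq> Field (cycle_poset k)"
      using word_order_refl unfolding cycle_poset_eq Field_def by fast
  qed
  then show ?thesis unfolding atLeastAtMost_1_4 set_cycle_chain by auto
qed

lemma cycle_poset_le:
  "(X a, X b) \<in> cycle_poset k \<longleftrightarrow> a = b \<and> a \<in> {1, 2}"
  "(X a, Z b) \<in> cycle_poset k \<longleftrightarrow> a \<in> {1, 2} \<and> b \<in> {1, 2}"
  "(X a, Y p j) \<in> cycle_poset k \<longleftrightarrow> a = p div 2 mod 2 + 1 \<and> p \<in> {1..4} \<and> 1 \<le> j \<and> j \<le> k p"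
  "(Y p i, Y q j) \<in> cycle_poset k \<longleftrightarrow> p = q \<and> p \<in> {1..4} \<and> 1 \<le> i \<and> i \<le> j \<and> j \<le> k p"
  "(Y p j, Z b) \<in> cycle_poset k \<longleftrightarrow> b = (p + 1) div 2 \<and> p \<in> {1..4} \<and> 1 \<le> j \<and> j \<le> k p"
  "(Z a, Z b) \<in> cycle_poset k \<longleftrightarrow> a = b \<and> a \<in> {1, 2}"
  "(Z a, X b) \<notin> cycle_poset k" "(Z a, Y p j) \<notin> cycle_poset k" "(Y p j, X a) \<notin> cycle_poset k"
  unfolding cycle_poset_eq word_order_cycle_chain atLeastAtMost_1_4 by auto

section \<open>The three orders of blocks\<close>

definition A_blocks :: "(nat \<Rightarrow> nat) \<Rightarrow> nat \<Rightarrow> (cycle_elem \<times> part) list \<Rightarrow> (cycle_elem \<times> part) list" where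
  "A_blocks k p bs =
    rev (chain_map (\<lambda>j. (Y p j, Im)) (k p)) @ bs @ chain_map (\<lambda>j. (Y p j, Vp)) (k p)"

definition B_blocks :: "(nat \<Rightarrow> nat) \<Rightarrow> nat \<Rightarrow> (cycle_elem \<times> part) list \<Rightarrow> (cycle_elem \<times> part) list" where
  "B_blocks k p bs =
    chain_map (\<lambda>j. (Y p j, Vm)) (k p) @ bs @ rev (chain_map (\<lambda>j. (Y p j, Ip)) (k p))"

definition C_blocks :: "(nat \<Rightarrow> nat) \<Rightarrow> nat \<Rightarrow> (cycle_elem \<times> part) list" where
  "C_blocks k p = chain_map (\<lambda>j. (Y p j, Vb)) (k p)"

definition order_1 :: "(nat \<Rightarrow> nat) \<Rightarrow> (cycle_elem \<times> part) list" where
  "order_1 k = A_blocks k 1 [(X 1, Vm)] @ [(X 2, Vm)] @ B_blocks k 2 [(Z 1, Vb)] @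
    B_blocks k 3 (B_blocks k 4 [(Z 2, Vb)]) @ [(X 1, Ip)] @ [(X 2, Ip)]"

definition order_2 :: "(nat \<Rightarrow> nat) \<Rightarrow> (cycle_elem \<times> part) list" where
  "order_2 k = [(Z 2, Im)] @ [(Z 1, Im)] @ A_blocks k 2 (A_blocks k 3 [(X 2, Vb)]) @
    A_blocks k 4 [(X 1, Vb)] @ [(Z 2, Vp)] @ B_blocks k 1 [(Z 1, Vp)]"

definition order_3 :: "(nat \<Rightarrow> nat) \<Rightarrow> (cycle_elem \<times> part) list" where
  "order_3 k = [(X 1, Im)] @ [(X 1, Vp)] @ C_blocks k 4 @ [(X 2, Im)] @ [(X 2, Vp)] @
    C_blocks k 1 @ C_blocks k 3 @ [(Z 2, Vm)] @ [(Z 2, Ip)] @ C_blocks k 2 @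
    [(Z 1, Vm)] @ [(Z 1, Ip)]"

lemmas blocks_defs = A_blocks_def B_blocks_def C_blocks_def order_1_def order_2_def order_3_def

lemma block_word_append: "block_word r W (bs @ cs) = block_word r W bs @ block_word r W cs"
  by (simp add: block_word_def)

lemma block_word_A_blocks: "block_word r W (A_blocks k p bs) = A_word k r W p (block_word r W bs)"
  by (simp add: A_blocks_def A_word_def block_word_def chain_map_def prod_up_def prod_down_def
      comp_def rev_map del: upt_Suc)

lemma block_word_B_blocks: "block_word r W (B_blocks k p bs) = B_word k r W p (block_word r W bs)"
  by (simp add: B_blocks_def B_word_def block_word_def chain_map_def prod_up_def prod_down_def
      comp_def rev_map del: upt_Suc)

lemma block_word_C_blocks: "block_word r W (C_blocks k p) = C_word k r W p"
  by (simp add: C_blocks_def C_word_def block_word_def chain_map_def prod_up_def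
      comp_def del: upt_Suc)

lemma block_word_single: "block_word r W [(v, p)] = block r W (v, p)"
  by (simp add: block_word_def)

lemma all_part: "(\<forall>p. R p) \<longleftrightarrow> R Im \<and> R Vp \<and> R Vm \<and> R Ip \<and> R Vb"
  by (metis part.exhaust)

lemma in_order_1: "(v, q) \<in> set (order_1 k) \<longleftrightarrow> v \<in> Field (cycle_poset k) \<and>
    (case v of X i \<Rightarrow> q \<in> {Vm, Ip} | Z i \<Rightarrow> q = Vb
      | Y p j \<Rightarrow> if p = 1 then q \<in> {Im, Vp} else q \<in> {Vm, Ip})"
  unfolding blocks_defs set_append set_rev set_chain_map Field_cycle_poset atLeastAtMost_1_4
  by (cases v; cases q) auto

lemma in_order_2: "(v, q) \<in> set (order_2 k) \<longleftrightarrow> v \<in> Field (cycle_poset k) \<and>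
    (case v of X i \<Rightarrow> q = Vb | Z i \<Rightarrow> q \<in> {Im, Vp}
      | Y p j \<Rightarrow> if p = 1 then q \<in> {Vm, Ip} else q \<in> {Im, Vp})"
  unfolding blocks_defs set_append set_rev set_chain_map Field_cycle_poset atLeastAtMost_1_4
  by (cases v; cases q) auto

lemma in_order_3: "(v, q) \<in> set (order_3 k) \<longleftrightarrow> v \<in> Field (cycle_poset k) \<and>
    (case v of X i \<Rightarrow> q \<in> {Im, Vp} | Z i \<Rightarrow> q \<in> {Vm, Ip} | Y p j \<Rightarrow> q = Vb)"
  unfolding blocks_defs set_append set_rev set_chain_map Field_cycle_poset atLeastAtMost_1_4
  by (cases v; cases q) auto

lemma distinct_orders: "distinct (order_1 k)" "distinct (order_2 k)" "distinct (order_3 k)"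
  unfolding blocks_defs by (auto simp: distinct_chain_map inj_def set_chain_map)

lemma cycle_elem_cases [consumes 1, case_names X1 X2 Z1 Z2 Y1 Y2 Y3 Y4]:
  assumes "v \<in> Field (cycle_poset k)"
  obtains "v = X 1" | "v = X 2" | "v = Z 1" | "v = Z 2"
    | j where "v = Y 1 j" "1 \<le> j" "j \<le> k 1" | j where "v = Y 2 j" "1 \<le> j" "j \<le> k 2"
    | j where "v = Y 3 j" "1 \<le> j" "j \<le> k 3" | j where "v = Y 4 j" "1 \<le> j" "j \<le> k 4"
  using assms unfolding Field_cycle_poset atLeastAtMost_1_4 by blast

lemmas order_simps = blocks_defs word_order_chain_map word_order_rev set_chain_map

lemma order_forms:
  assumes "v \<in> Field (cycle_poset k)"
  shows "case v of
      X i \<Rightarrow> has_form_B (order_1 k) v \<and> has_form_C (order_2 k) v \<and> has_form_A (order_3 k) v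
    | Z i \<Rightarrow> has_form_C (order_1 k) v \<and> has_form_A (order_2 k) v \<and> has_form_B (order_3 k) v
    | Y p j \<Rightarrow> has_form_C (order_3 k) v \<and>
       (if p = 1 then has_form_A (order_1 k) v \<and> has_form_B (order_2 k) v
        else has_form_B (order_1 k) v \<and> has_form_A (order_2 k) v)"
  using assms
  by (cases rule: cycle_elem_cases;
      simp add: has_form_A_def has_form_B_def has_form_C_def in_order_1 in_order_2 in_order_3;
      simp add: order_simps)

lemma cycle_less_cases [consumes 2, case_names XZ XY YY YZ]:
  assumes "(v, v') \<in> cycle_poset k" "v \<noteq> v'"
  obtains a b where "v = X a" "v' = Z b" "a = 1 \<or> a = 2" "b = 1 \<or> b = 2"
    | p j where "v = X (if p = 1 \<or> p = 4 then 1 else 2)" "v' = Y p j"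
       "p = 1 \<or> p = 2 \<or> p = 3 \<or> p = 4" "1 \<le> j" "j \<le> k p"
    | p i j where "v = Y p i" "v' = Y p j" "p = 1 \<or> p = 2 \<or> p = 3 \<or> p = 4"
       "1 \<le> i" "i < j" "j \<le> k p"
    | p j where "v = Y p j" "v' = Z (if p = 1 \<or> p = 2 then 1 else 2)"
       "p = 1 \<or> p = 2 \<or> p = 3 \<or> p = 4" "1 \<le> j" "j \<le> k p"
proof (cases v)
  case (X a)
  show ?thesis
  proof (cases v')
    case (Y p j)
    then have "a = p div 2 mod 2 + 1" "p = 1 \<or> p = 2 \<or> p = 3 \<or> p = 4" "1 \<le> j" "j \<le> k p"
      using assms X by (auto simp: cycle_poset_le atLeastAtMost_1_4)
    moreover from this have "a = (if p = 1 \<or> p = 4 then 1 else 2)" by auto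
    ultimately show ?thesis using that(2) X Y by blast
  qed (use assms X that(1) in \<open>auto simp: cycle_poset_le\<close>)
next
  case (Z a)
  then show ?thesis using assms by (cases v') (auto simp: cycle_poset_le)
next
  case (Y p i)
  then have "1 \<le> p \<and> p \<le> 4" using assms by (cases v') (auto simp: cycle_poset_le)
  then have p: "p = 1 \<or> p = 2 \<or> p = 3 \<or> p = 4" by auto
  show ?thesis
  proof (cases v')
    case (Z b)
    then have "b = (p + 1) div 2" "1 \<le> i" "i \<le> k p" using assms Y by (auto simp: cycle_poset_le)
    moreover from this have "b = (if p = 1 \<or> p = 2 then 1 else 2)" using p by auto
    ultimately show ?thesis using that(4) Y Z p by blast
  next
    case (Y q j)
    then have "q = p" "1 \<le> i" "i \<le> j" "i \<noteq> j" "j \<le> k p"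
      using assms \<open>v = Y p i\<close> by (auto simp: cycle_poset_le)
    then show ?thesis using that(3)[of p i j] Y \<open>v = Y p i\<close> p by simp
  qed (use assms Y in \<open>simp add: cycle_poset_le\<close>)
qed

text \<open>Listing only the roots, the three orders are linear extensions of the cycle.\<close>

lemma order_1_roots:
  assumes "(v, v') \<in> cycle_poset k" "v \<noteq> v'"
    "(v, p) \<in> set (order_1 k)" "(v', q) \<in> set (order_1 k)" "p \<in> {Vp, Vm, Vb}" "q \<in> {Vp, Vm, Vb}"
  shows "((v, p), (v', q)) \<in> word_order (order_1 k)"
proof -
  let ?root = "\<lambda>v. case v of X _ \<Rightarrow> Vm | Z _ \<Rightarrow> Vb | Y p _ \<Rightarrow> if p = 1 then Vp else Vm"
  have "p = ?root v" "q = ?root v'"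
    using assms(3-6) by (auto simp: in_order_1 split: cycle_elem.splits if_splits)
  with assms(1,2) show ?thesis
    by (cases rule: cycle_less_cases; elim disjE; simp add: order_simps)
qed

lemma order_2_roots:
  assumes "(v, v') \<in> cycle_poset k" "v \<noteq> v'"
    "(v, p) \<in> set (order_2 k)" "(v', q) \<in> set (order_2 k)" "p \<in> {Vp, Vm, Vb}" "q \<in> {Vp, Vm, Vb}"
  shows "((v, p), (v', q)) \<in> word_order (order_2 k)"
proof -
  let ?root = "\<lambda>v. case v of X _ \<Rightarrow> Vb | Z _ \<Rightarrow> Vp | Y p _ \<Rightarrow> if p = 1 then Vm else Vp"
  have "p = ?root v" "q = ?root v'"
    using assms(3-6) by (auto simp: in_order_2 split: cycle_elem.splits if_splits)
  with assms(1,2) show ?thesis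
    by (cases rule: cycle_less_cases; elim disjE; simp add: order_simps)
qed

lemma order_3_roots:
  assumes "(v, v') \<in> cycle_poset k" "v \<noteq> v'"
    "(v, p) \<in> set (order_3 k)" "(v', q) \<in> set (order_3 k)" "p \<in> {Vp, Vm, Vb}" "q \<in> {Vp, Vm, Vb}"
  shows "((v, p), (v', q)) \<in> word_order (order_3 k)"
proof -
  let ?root = "\<lambda>v. case v of X _ \<Rightarrow> Vp | Z _ \<Rightarrow> Vm | Y _ _ \<Rightarrow> Vb"
  have "p = ?root v" "q = ?root v'"
    using assms(3-6) by (auto simp: in_order_3 split: cycle_elem.splits if_splits)
  with assms(1,2) show ?thesis
    by (cases rule: cycle_less_cases; elim disjE; simp add: order_simps)
qed

text \<open>Order 2 starts with $I^-$ of \<open>Z 2\<close> and \<open>Z 1\<close>, and the operation A puts the blocks $I^-$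
  of a chain in front of its lower end, in decreasing order along the chain.  The first chain
  enters order 1 through A, the other chains enter order 2 through A.\<close>

lemma order_early:
  assumes "(v, v') \<in> cycle_poset k" "v \<noteq> v'"
  shows "before_all (if \<exists>j. v' = Y 1 j then order_1 k else order_2 k) (v', Im) v"
proof -
  have "v \<in> Field (cycle_poset k)" "v' \<in> Field (cycle_poset k)" using assms by (auto simp: Field_def)
  with assms show ?thesis
    by (cases rule: cycle_less_cases; elim disjE;
        simp add: before_all_def all_part in_order_1 in_order_2; simp add: order_simps)
qed

text \<open>Dually, order 1 ends with $I^+$ of \<open>X 1\<close> and \<open>X 2\<close>, and the operation B puts the blocks
  $I^+$ of a chain behind its upper end, again in decreasing order.  The first chain enters
  order 2 through B, the other chains enter order 1 through B.\<close>

lemma order_late: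
  assumes "(v, v') \<in> cycle_poset k" "v \<noteq> v'"
  shows "after_all (if \<exists>j. v = Y 1 j then order_2 k else order_1 k) (v, Ip) v'"
proof -
  have "v \<in> Field (cycle_poset k)" "v' \<in> Field (cycle_poset k)" using assms by (auto simp: Field_def)
  with assms show ?thesis
    by (cases rule: cycle_less_cases; elim disjE;
        simp add: after_all_def all_part in_order_1 in_order_2; simp add: order_simps)
qed

text \<open>In order 3 the blocks of each tree are adjacent, so it lists whole trees along a linear
  extension of the cycle.  This settles the pairs \<open>v' < v\<close> and one direction for incomparable
  pairs; the other direction is found in order 1 or order 2.\<close>

lemma order_separated:
  assumes "v \<in> Field (cycle_poset k)" "v' \<in> Field (cycle_poset k)" "(v, v') \<notin> cycle_poset k" "v \<noteq> v'"
  shows "\<exists>bs \<in> {order_1 k, order_2 k, order_3 k}.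
    \<forall>p. (v', p) \<in> set bs \<longrightarrow> before_all bs (v', p) v"
proof -
  \<comment> \<open>With the kinds of \<open>v\<close> and \<open>v'\<close> fixed, all positions are decided by linear arithmetic.\<close>
  let ?P = "\<lambda>bs. \<forall>p. (v', p) \<in> set bs \<longrightarrow> before_all bs (v', p) v"
  have "?P (order_1 k) \<or> ?P (order_2 k) \<or> ?P (order_3 k)"
    using assms(1,2,3,4)
    by (cases rule: cycle_elem_cases[OF assms(1)]; cases rule: cycle_elem_cases[OF assms(2)],
        simp_all add: cycle_poset_le atLeastAtMost_1_4,
        simp_all add: before_all_def all_part in_order_1 in_order_2 in_order_3,
        simp_all add: order_simps)
  then show ?thesis by blast
qed


section \<open>The three linear orders\<close>

theorem proposition9p3:
  fixes k :: "nat \<Rightarrow> nat"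
    and T :: "cycle_elem \<Rightarrow> 'a rel"
    and r :: "cycle_elem \<Rightarrow> 'a"
    and W :: "cycle_elem \<Rightarrow> 'a words"
    and P :: "(cycle_elem \<times> 'a) rel"
  assumes trees: "\<And>v. v \<in> Field (cycle_poset k) \<Longrightarrow> rooted_tree_poset (T v) (r v)"
    and words: "\<And>v. v \<in> Field (cycle_poset k) \<Longrightarrow> admissible (T v) (r v) (W v)"
    and P: "P = grafting (cycle_poset k) T r"
  shows "realizer P
    [A_word k r W 1 (V_minus r W (X 1)) @ V_minus r W (X 2) @
       B_word k r W 2 (V_bullet r W (Z 1)) @
       B_word k r W 3 (B_word k r W 4 (V_bullet r W (Z 2))) @
       I_plus W (X 1) @ I_plus W (X 2),
     I_minus W (Z 2) @ I_minus W (Z 1) @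
       A_word k r W 2 (A_word k r W 3 (V_bullet r W (X 2))) @
       A_word k r W 4 (V_bullet r W (X 1)) @
       V_plus r W (Z 2) @ B_word k r W 1 (V_plus r W (Z 1)),
     I_minus W (X 1) @ V_plus r W (X 1) @ C_word k r W 4 @
       I_minus W (X 2) @ V_plus r W (X 2) @ C_word k r W 1 @ C_word k r W 3 @
       V_minus r W (Z 2) @ I_plus W (Z 2) @ C_word k r W 2 @
       V_minus r W (Z 1) @ I_plus W (Z 1)]"
proof -
  let ?Q = "cycle_poset k" and ?bss = "[order_1 k, order_2 k, order_3 k]"
  have "realizer (grafting ?Q T r) (map (block_word r W) ?bss)"
  proof (rule realizer_grafting)
    fix bs assume bs: "bs \<in> set ?bss"
    then show "distinct bs" using distinct_orders by auto
    show "fst ` set bs \<subseteq> Field ?Q" using bs by (auto simp: in_order_1 in_order_2 in_order_3)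
    show "has_form_A bs v \<or> has_form_B bs v \<or> has_form_C bs v" if "v \<in> Field ?Q" for v
      using bs order_forms[OF that] by (auto split: cycle_elem.splits if_splits)
    show "((v, p), (v', q)) \<in> word_order bs"
      if "(v, v') \<in> ?Q" "v \<noteq> v'" "(v, p) \<in> set bs" "(v', q) \<in> set bs"
        "p \<in> {Vp, Vm, Vb}" "q \<in> {Vp, Vm, Vb}" for v v' p q
      using bs that order_1_roots[of v v' k p q] order_2_roots[of v v' k p q]
        order_3_roots[of v v' k p q] by auto
  next
    fix v assume "v \<in> Field ?Q"
    from order_forms[OF this]
    show "(\<exists>bs \<in> set ?bss. has_form_A bs v) \<and> (\<exists>bs \<in> set ?bss. has_form_B bs v) \<and>
        (\<exists>bs \<in> set ?bss. has_form_C bs v)"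
      by (auto split: cycle_elem.splits if_splits)
  next
    fix v v' assume "v \<in> Field ?Q" "v' \<in> Field ?Q" "(v, v') \<notin> ?Q" "v \<noteq> v'"
    from order_separated[OF this]
    show "\<exists>bs \<in> set ?bss. \<forall>p. (v', p) \<in> set bs \<longrightarrow> before_all bs (v', p) v" by simp
  next
    fix v v' assume vv': "(v, v') \<in> ?Q" "v \<noteq> v'"
    show "\<exists>bs \<in> set ?bss. before_all bs (v', Im) v"
      using order_early[OF vv'] by (auto split: if_splits)
    show "\<exists>bs \<in> set ?bss. after_all bs (v, Ip) v'"
      using order_late[OF vv'] by (auto split: if_splits)
  qed (use trees words in auto)
  then show ?thesis
    unfolding P order_1_def order_2_def order_3_def
    by (simp add: block_word_append block_word_A_blocks block_word_B_blocks block_word_C_blocks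
        block_word_single del: append_Cons)
qed

end
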